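(* Let $p=p(n)$. If $p \ge \frac{8\log n}{n}$, then with high probability $G_{n,p}$ has the EG Property.
   Context: $\log$ denotes the natural logarithm. $G_{n,p}$ is the Erdős–Rényi random graph on $n$ labelled vertices in which each of the $\binom n2$ possible edges is present independently with probability $p$. "With high probability" means with probability tending to $1$ as $n\to\infty$. For a graph $G$, the matching number $\nu(G)$ is the size of a largest matching in $G$. The size of a graph is its number of edges. Thus a largest subgraph of $G$ with matching number $k$ is a subgraph $H\subseteq G$ with $\nu(H)=k$ having the maximum number of edges among all such subgraphs. Subgraphs of $G$ are taken to have vertex set $V(G)$ and are identified with their edge sets. A graph $G$ has the EG Property if for each $k\le \nu(G)$ every largest subgraph of $G$ with matching number $k$ has one of the following two forms: (1) all edges of $G$ within a fixed set of vertices of size $2k+1$; (2) all edges of $G$ meeting a fixed set of vertices of size $k$ (that is, having at least one endpoint in that set).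
   Formalization: In form (1) the vertex set has size min(2k+1, n): when n is even and k = n/2 no set of size 2k+1 exists, and the claim read literally fails (e.g. p = 1); there the set is all of V(G). The bound on p is required only for large n. *)

theory Defs
  imports "HOL-Probability.Probability" "HOL-Probability.Product_PMF"
begin

text \<open>
  A simple graph on a vertex set \<open>V\<close> is represented by its edge set, a subset of \<open>complete_edges V\<close>.
  Subgraphs keep the vertex set, so the subgraphs of \<open>E\<close> are exactly the subsets of \<open>E\<close>.
\<close>

definition complete_edges :: "'a set \<Rightarrow> 'a set set" where
  "complete_edges V = {e. e \<subseteq> V \<and> card e = 2}"

definition is_matching :: "'a set set \<Rightarrow> 'a set set \<Rightarrow> bool" where
  "is_matching E M \<longleftrightarrow> M \<subseteq> E \<and> pairwise disjnt M"

text \<open>Only meaningful for finite \<open>E\<close>, since \<open>Max\<close> is unspecified on infinite sets.\<close>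

definition matching_number :: "'a set set \<Rightarrow> nat" where
  "matching_number E = Max {card M | M. is_matching E M}"

definition largest_subgraph_with_matching_number ::
    "'a set set \<Rightarrow> nat \<Rightarrow> 'a set set \<Rightarrow> bool" where
  "largest_subgraph_with_matching_number E k H \<longleftrightarrow>
     H \<subseteq> E \<and> matching_number H = k \<and>
     (\<forall>H'. H' \<subseteq> E \<and> matching_number H' = k \<longrightarrow> card H' \<le> card H)"

text \<open>
  The first form asks for a vertex set of size \<open>2 * k + 1\<close>.  Since \<open>2 * matching_number E \<le> card V\<close>,
  such a set exists for every relevant \<open>k\<close> except when \<open>E\<close> has a perfect matching and
  \<open>2 * k = card V\<close>.  In that case the only largest subgraph is \<open>E\<close> itself and the set is taken to be
  \<open>V\<close>; this is the sole effect of the \<open>min\<close> below.  (Without it the complete graph on 4 vertices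
  would fail at \<open>k = 2\<close>.)
\<close>

definition EG_property :: "'a set \<Rightarrow> 'a set set \<Rightarrow> bool" where
  "EG_property V E \<longleftrightarrow>
     (\<forall>k \<le> matching_number E. \<forall>H. largest_subgraph_with_matching_number E k H \<longrightarrow>
        (\<exists>A \<subseteq> V. card A = min (2 * k + 1) (card V) \<and> H = {e \<in> E. e \<subseteq> A}) \<or>
        (\<exists>A \<subseteq> V. card A = k \<and> H = {e \<in> E. e \<inter> A \<noteq> {}}))"

text \<open>
  The random graph \<open>G(n,p)\<close> on the vertex set \<open>{..<n}\<close>, as a distribution on edge sets: an independent
  \<open>p\<close>-coin is flipped for each potential edge (the \<open>False\<close> is the value of the coin function outside
  the index set).
\<close>

definition random_graph :: "nat \<Rightarrow> real \<Rightarrow> nat set set pmf" where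
  "random_graph n p =
     map_pmf (\<lambda>coin. {e \<in> complete_edges {..<n}. coin e})
       (Pi_pmf (complete_edges {..<n}) False (\<lambda>_. bernoulli_pmf p))"

end

theory Submission
  imports Defs "HOL-Real_Asymp.Real_Asymp"
begin

text \<open>
  Let \<open>H\<close> be a largest subgraph with matching number \<open>k\<close>.  By the Tutte--Berge formula there are a set
  \<open>S\<close> and a partition \<open>P\<close> of the remaining vertices into odd parts such that \<open>H\<close> consists of the edges
  of \<open>E\<close> that meet \<open>S\<close> or lie inside a part, and \<open>k = card S + (\<Sum>C\<in>P. card C div 2)\<close>.  If all parts
  are singletons, this is the second form.  Otherwise three comparisons with other subgraphs of
  matching number at most \<open>k\<close> apply.

  \<^item> Dissolving all parts and enlarging \<open>S\<close> to size \<open>k\<close> instead gains edges unless some part \<open>C\<close>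
    contains nearly four fifths of the vertices outside \<open>S\<close>.
  \<^item> If \<open>C\<close> is that large, moving vertices of the other nontrivial parts to \<open>C\<close> gains edges, so the
    other parts are singletons.
  \<^item> If moreover \<open>S\<close> is nonempty, let \<open>W\<close> be the set of the remaining vertices.  Moving \<open>S\<close> and
    \<open>card S\<close> vertices of \<open>W\<close> to \<open>C\<close> gains edges if a vertex of \<open>W\<close> has on average more neighbours
    outside \<open>W\<close> than a vertex of \<open>S\<close> has inside \<open>W\<close>.  An adversarial \<open>W\<close> could be rich in neighbours
    of \<open>S\<close>; but \<open>W\<close> may be replaced by any set of the same size meeting the fewest edges
    outside \<open>S\<close>, and such a set can be chosen independently of the edges at \<open>S\<close>.

  The random graph inputs are Chernoff bounds and union bounds.
\<close>

section \<open>Matchings and the Tutte--Berge formula\<close>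

lemma finite_complete_edges: "finite V \<Longrightarrow> finite (complete_edges V)"
  by (rule finite_subset[of _ "Pow V"]) (auto simp: complete_edges_def)

lemma matching_empty: "is_matching E {}"
  by (simp add: is_matching_def)

lemma finite_matchings: "finite E \<Longrightarrow> finite {card M | M. is_matching E M}"
proof -
  assume "finite E"
  have "{card M | M. is_matching E M} \<subseteq> card ` Pow E"
    by (auto simp: is_matching_def)
  then show ?thesis using \<open>finite E\<close> finite_subset by blast
qed

lemma card_matching_le: "finite E \<Longrightarrow> is_matching E M \<Longrightarrow> card M \<le> matching_number E"
  unfolding matching_number_def by (rule Max_ge) (auto intro: finite_matchings)

lemma ex_maximum_matching:
  assumes "finite E" obtains M where "is_matching E M" "card M = matching_number E"
proof -
  have "matching_number E \<in> {card M | M. is_matching E M}"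
    unfolding matching_number_def
    by (rule Max_in) (use assms matching_empty[of E] in \<open>auto intro: finite_matchings\<close>)
  then show ?thesis using that by auto
qed

lemma matching_number_insert:
  assumes "finite E" shows "matching_number (insert e E) \<le> matching_number E + 1"
proof -
  obtain M where M: "is_matching (insert e E) M" "card M = matching_number (insert e E)"
    using ex_maximum_matching[of "insert e E"] assms by auto
  have "is_matching E (M - {e})"
    using M by (auto simp: is_matching_def pairwise_def)
  then have "card (M - {e}) \<le> matching_number E" by (rule card_matching_le[OF assms])
  then show ?thesis using M(2) by (simp add: card_Diff_singleton_if split: if_splits)
qed

lemma card_Union_matching:
  assumes "pairwise disjnt M" "\<And>e. e \<in> M \<Longrightarrow> card e = 2"
  shows "card (\<Union>M) = 2 * card M"
proof -
  have "card (\<Union>M) = sum card M"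
    by (rule card_Union_disjoint) (use assms in \<open>auto intro: card_ge_0_finite\<close>)
  then show ?thesis using assms by simp
qed

lemma two_matching_number_le:
  assumes "finite V" "E \<subseteq> complete_edges V" shows "2 * matching_number E \<le> card V"
proof -
  have "finite E" using assms finite_complete_edges finite_subset by blast
  then obtain M where M: "is_matching E M" "card M = matching_number E"
    using ex_maximum_matching by blast
  have "card (\<Union>M) = 2 * card M"
    using M assms by (intro card_Union_matching) (auto simp: is_matching_def complete_edges_def)
  moreover have "\<Union>M \<subseteq> V" using M assms by (auto simp: is_matching_def complete_edges_def)
  ultimately show ?thesis using M card_mono[OF assms(1)] by metis
qed

text \<open>A discrete intermediate value argument: adding the missing edges one at a time raises
  the matching number by at most one per step and ends at \<open>matching_number E\<close>, which is
  at least \<open>k\<close>. So \<open>H'\<close> extends to a subgraph with matching number exactly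
  \<open>k\<close>, and competitors of \<open>H\<close> only need an upper bound on their matching
  number.\<close>

lemma largest_subgraph_ge:
  assumes "finite E" "largest_subgraph_with_matching_number E k H" "k \<le> matching_number E"
    and "H' \<subseteq> E" "matching_number H' \<le> k"
  shows "card H' \<le> card H"
  using assms(4,5)
proof (induction "card E - card H'" arbitrary: H' rule: less_induct)
  case less
  show ?case
  proof (cases "matching_number H' = k")
    case True
    then show ?thesis using assms less by (auto simp: largest_subgraph_with_matching_number_def)
  next
    case False
    then have "H' \<noteq> E" using assms(3) less by auto
    then obtain e where e: "e \<in> E" "e \<notin> H'" using less by auto
    have fin: "finite H'" using less assms finite_subset by blast
    have "matching_number (insert e H') \<le> k"
      using matching_number_insert[OF fin, of e] False less by simp
    moreover have c: "card (insert e H') = card H' + 1" using e fin by simp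
    moreover have "card (insert e H') \<le> card E"
      using e less assms(1) by (intro card_mono) auto
    ultimately have "card (insert e H') \<le> card H"
      using e less by (intro less.hyps) auto
    then show ?thesis using c by simp
  qed
qed

text \<open>The easy direction of the Tutte--Berge formula: each matching edge uses up a vertex of
  \<open>S\<close> or two vertices of some part.\<close>

lemma matching_number_le_cover:
  assumes "finite S" "finite P" "\<And>C. C \<in> P \<Longrightarrow> finite C"
    and "finite E" "\<And>e. e \<in> E \<Longrightarrow> card e = 2"
    and "\<And>e. e \<in> E \<Longrightarrow> e \<inter> S \<noteq> {} \<or> (\<exists>C\<in>P. e \<subseteq> C)"
  shows "matching_number E \<le> card S + (\<Sum>C\<in>P. card C div 2)"
proof -
  obtain M where M: "is_matching E M" "card M = matching_number E"
    using ex_maximum_matching assms by blast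
  have disj: "pairwise disjnt M" and ME: "M \<subseteq> E" using M by (auto simp: is_matching_def)
  have finM: "finite M" using ME assms finite_subset by blast
  let ?MS = "{e \<in> M. e \<inter> S \<noteq> {}}"
  have "card ?MS \<le> card S"
  \<comment> \<open>Selecting a vertex of \<open>S\<close> from each edge is injective because the
    edges of a matching are disjoint.\<close>
  proof (rule card_inj_on_le[where f = "\<lambda>e. SOME x. x \<in> e \<inter> S"])
    have *: "(SOME x. x \<in> e \<inter> S) \<in> e \<inter> S" if "e \<in> ?MS" for e
      by (rule someI_ex[of "\<lambda>x. x \<in> e \<inter> S"]) (use that in auto)
    show "(\<lambda>e. SOME x. x \<in> e \<inter> S) ` ?MS \<subseteq> S" using * by blast
    show "inj_on (\<lambda>e. SOME x. x \<in> e \<inter> S) ?MS"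
    proof (rule inj_onI)
      fix e f assume ef: "e \<in> ?MS" "f \<in> ?MS" "(SOME x. x \<in> e \<inter> S) = (SOME x. x \<in> f \<inter> S)"
      then have "\<not> disjnt e f" using *[of e] *[of f] by (auto simp: disjnt_def)
      then show "e = f" using ef disj by (auto simp: pairwise_def)
    qed
  qed (use assms in auto)
  moreover have "card {e \<in> M. e \<subseteq> C} \<le> card C div 2" if "C \<in> P" for C
  proof -
    have "card (\<Union>{e \<in> M. e \<subseteq> C}) = 2 * card {e \<in> M. e \<subseteq> C}"
      using disj ME assms by (intro card_Union_matching) (auto simp: pairwise_def)
    moreover have "card (\<Union>{e \<in> M. e \<subseteq> C}) \<le> card C"
      using assms that by (intro card_mono) auto
    ultimately show ?thesis by simp
  qed
  then have "(\<Sum>C\<in>P. card {e \<in> M. e \<subseteq> C}) \<le> (\<Sum>C\<in>P. card C div 2)" by (rule sum_mono)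
  moreover have "card (\<Union>C\<in>P. {e \<in> M. e \<subseteq> C}) \<le> (\<Sum>C\<in>P. card {e \<in> M. e \<subseteq> C})"
    by (rule card_UN_le) (rule assms)
  moreover have "card M \<le> card (?MS \<union> (\<Union>C\<in>P. {e \<in> M. e \<subseteq> C}))"
    using assms finM ME by (intro card_mono) auto
  moreover have "card (?MS \<union> (\<Union>C\<in>P. {e \<in> M. e \<subseteq> C})) \<le> card ?MS + card (\<Union>C\<in>P. {e \<in> M. e \<subseteq> C})"
    by (rule card_Un_le)
  ultimately show ?thesis using M by linarith
qed

section \<open>Gallai's lemma and the hard direction of the Tutte--Berge formula\<close>

definition maximum_matching :: "'a set set \<Rightarrow> 'a set set \<Rightarrow> bool" where
  "maximum_matching E M \<longleftrightarrow> is_matching E M \<and> card M = matching_number E"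

text \<open>
  Gallai's lemma.  Among the maximum matchings missing \<open>t\<close>, take one sharing as many edges as
  possible with \<open>M\<close>; if \<open>M\<close> missed \<open>u\<close> and \<open>v\<close>, an exchange would increase the overlap.
\<close>

lemma gallai_transitive:
  assumes E: "finite E" "\<And>e. e \<in> E \<Longrightarrow> card e = 2"
    and t: "maximum_matching E N" "t \<notin> \<Union>N"
    and ut: "\<And>M. maximum_matching E M \<Longrightarrow> u \<in> \<Union>M \<or> t \<in> \<Union>M"
    and tv: "\<And>M. maximum_matching E M \<Longrightarrow> t \<in> \<Union>M \<or> v \<in> \<Union>M"
    and M: "maximum_matching E M" and "u \<noteq> v"
  shows "u \<in> \<Union>M \<or> v \<in> \<Union>M"
proof (rule ccontr)
  assume uv: "\<not> (u \<in> \<Union>M \<or> v \<in> \<Union>M)"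
  define Q where "Q N \<longleftrightarrow> maximum_matching E N \<and> t \<notin> \<Union>N" for N
  have finmax: "finite M'" if "maximum_matching E M'" for M'
    using that E(1) by (auto simp: maximum_matching_def is_matching_def intro: finite_subset)
  have "\<exists>N. Q N \<and> (\<forall>N'. Q N' \<longrightarrow> card (M \<inter> N') \<le> card (M \<inter> N))"
  proof (rule ex_has_greatest_nat[where P = Q and f = "\<lambda>N. card (M \<inter> N)" and b = "Suc (card M)"])
    show "Q N" using t by (simp add: Q_def)
    show "\<forall>N'. Q N' \<longrightarrow> card (M \<inter> N') < Suc (card M)"
      using finmax[OF M] by (auto simp: less_Suc_eq_le intro!: card_mono)
  qed
  then obtain N where N: "Q N" and Nmax: "\<And>N'. Q N' \<Longrightarrow> card (M \<inter> N') \<le> card (M \<inter> N)" by blast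
  have Nm: "maximum_matching E N" and tN: "t \<notin> \<Union>N" using N by (auto simp: Q_def)
  have card_cover: "card (\<Union>M') = 2 * matching_number E" "finite (\<Union>M')" if "maximum_matching E M'" for M'
  proof -
    show "card (\<Union>M') = 2 * matching_number E"
      using that card_Union_matching[of M'] E(2) by (auto simp: maximum_matching_def is_matching_def)
    have "finite e" if "e \<in> M'" for e
      using \<open>maximum_matching E M'\<close> that E(2)[of e]
      by (auto simp: maximum_matching_def is_matching_def intro!: card_ge_0_finite)
    then show "finite (\<Union>M')" using finmax[OF that] by blast
  qed
  have uN: "u \<in> \<Union>N" and vN: "v \<in> \<Union>N" using ut[OF Nm] tv[OF Nm] tN by auto
  have tM: "t \<in> \<Union>M" using ut[OF M] uv by auto
  \<comment> \<open>Both matchings cover equally many vertices, and \<open>u\<close> and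
    \<open>v\<close> are covered by \<open>N\<close> only. Hence at least two vertices are covered
    by \<open>M\<close> only, and one of them, \<open>x\<close>, differs from
    \<open>t\<close>.\<close>
  have eqd: "card (\<Union>M - \<Union>N) = card (\<Union>N - \<Union>M)"
    using card_cover[OF M] card_cover[OF Nm] card_Diff_subset_Int[of "\<Union>M" "\<Union>N"] card_Diff_subset_Int[of "\<Union>N" "\<Union>M"]
    by (simp add: Int_commute)
  have "card {u, v} \<le> card (\<Union>N - \<Union>M)"
    using uN vN uv card_cover[OF Nm] by (intro card_mono) auto
  then have "card (\<Union>M - \<Union>N) \<ge> 2" using eqd \<open>u \<noteq> v\<close> by simp
  then have "\<not> \<Union>M - \<Union>N \<subseteq> {t}"
    using card_mono[of "{t}" "\<Union>M - \<Union>N"] by auto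
  then obtain x e where x: "x \<noteq> t" "e \<in> M" "x \<in> e" "x \<notin> \<Union>N" by blast
  have eE: "e \<in> E" using M x by (auto simp: maximum_matching_def is_matching_def)
  then obtain y where e: "e = {x, y}" "x \<noteq> y"
    using E(2)[OF eE] x(3) by (metis card_2_iff insert_iff insert_commute singletonD)
  have NE: "N \<subseteq> E" "pairwise disjnt N" and cN: "card N = matching_number E"
    using Nm by (auto simp: maximum_matching_def is_matching_def)
  have eN: "e \<notin> N" using x by auto
  have "y \<in> \<Union>N"
  proof (rule ccontr)
    assume y: "y \<notin> \<Union>N"
    have "is_matching E (insert e N)"
      using NE eE y x(4) e by (auto simp: is_matching_def pairwise_insert disjnt_def)
    then have "card (insert e N) \<le> matching_number E" by (rule card_matching_le[OF E(1)])
    then show False using eN cN finmax[OF Nm] by simp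
  qed
  then obtain f where f: "f \<in> N" "y \<in> f" by blast
  have yt: "y \<noteq> t" using tN f by auto
  have fM: "f \<notin> M"
  proof
    assume "f \<in> M"
    moreover have "\<not> disjnt e f" using e f by (auto simp: disjnt_def)
    ultimately have "e = f" using M x by (auto simp: maximum_matching_def is_matching_def pairwise_def)
    then show False using f eN by simp
  qed
  \<comment> \<open>Exchanging \<open>f\<close> for \<open>e\<close> keeps the size and still misses
    \<open>t\<close>. The overlap with \<open>M\<close> grows, since \<open>e\<close> belongs to
    \<open>M\<close> and \<open>f\<close> does not.\<close>
  let ?N = "insert e (N - {f})"
  have yonly: "y \<notin> g" if "g \<in> N - {f}" for g
    using that f NE(2) by (auto simp: pairwise_def disjnt_def)
  have "is_matching E ?N"
    using NE eE yonly x(4) e by (auto simp: is_matching_def pairwise_insert disjnt_def pairwise_def)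
  moreover have "card ?N = matching_number E"
    using eN f cN finmax[OF Nm]
    by (metis Diff_iff card_Suc_Diff1 card_insert_disjoint finite_Diff)
  ultimately have "Q ?N" using tN x(1) yt e by (auto simp: Q_def maximum_matching_def)
  then have "card (M \<inter> ?N) \<le> card (M \<inter> N)" by (rule Nmax)
  moreover have "M \<inter> ?N = insert e (M \<inter> N)" using x fM by auto
  ultimately show False using eN finmax[OF M] by simp
qed

text \<open>Induction on the number of vertices. A vertex covered by every maximum matching is
  deleted and put into \<open>S\<close>. If there is none, \<open>S\<close> is empty and the parts
  are the classes of the relation that no maximum matching misses both vertices, which is transitive
  by Gallai's lemma.\<close>

theorem tutte_berge:
  assumes "finite V" "E \<subseteq> complete_edges V"
  obtains S P where "S \<subseteq> V" "\<Union>P = V - S" "pairwise disjnt P" "\<And>C. C \<in> P \<Longrightarrow> odd (card C)"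
    "\<And>e. e \<in> E \<Longrightarrow> e \<inter> S \<noteq> {} \<or> (\<exists>C\<in>P. e \<subseteq> C)"
    "card S + (\<Sum>C\<in>P. card C div 2) \<le> matching_number E"
proof -
  have "\<exists>S P. S \<subseteq> V \<and> \<Union>P = V - S \<and> pairwise disjnt P \<and> (\<forall>C\<in>P. odd (card C)) \<and>
    (\<forall>e\<in>E. e \<inter> S \<noteq> {} \<or> (\<exists>C\<in>P. e \<subseteq> C)) \<and> card S + (\<Sum>C\<in>P. card C div 2) \<le> matching_number E"
    using assms
  proof (induction "card V" arbitrary: V E rule: less_induct)
    case less
    have finE: "finite E" using less.prems finite_complete_edges finite_subset by blast
    have cardE: "card e = 2" "e \<subseteq> V" if "e \<in> E" for e
      using that less.prems by (auto simp: complete_edges_def)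
    show ?case
    proof (cases "\<exists>v\<in>V. \<forall>M. maximum_matching E M \<longrightarrow> v \<in> \<Union>M")
      case True
      then obtain v where v: "v \<in> V" "\<And>M. maximum_matching E M \<Longrightarrow> v \<in> \<Union>M" by blast
      let ?E = "{e \<in> E. v \<notin> e}"
      have "card (V - {v}) < card V" using v less.prems by (intro psubset_card_mono) auto
      moreover have "?E \<subseteq> complete_edges (V - {v})"
        using less.prems by (auto simp: complete_edges_def)
      ultimately obtain S P where SP: "S \<subseteq> V - {v}" "\<Union>P = V - {v} - S" "pairwise disjnt P"
        "\<forall>C\<in>P. odd (card C)" "\<forall>e\<in>?E. e \<inter> S \<noteq> {} \<or> (\<exists>C\<in>P. e \<subseteq> C)"
        "card S + (\<Sum>C\<in>P. card C div 2) \<le> matching_number ?E"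
        using less.hyps[of "V - {v}" ?E] less.prems by auto
      obtain M where M: "is_matching ?E M" "card M = matching_number ?E"
        using ex_maximum_matching[of ?E] finE by auto
      have M': "is_matching E M" "v \<notin> \<Union>M" using M by (auto simp: is_matching_def)
      \<comment> \<open>\<open>M\<close> misses \<open>v\<close>, so it is not maximum in
        \<open>E\<close>. The strict drop pays for the new element \<open>v\<close> of
        \<open>S\<close>.\<close>
      then have "matching_number ?E < matching_number E"
        using card_matching_le[OF finE M'(1)] v(2)[of M] M(2)
        by (auto simp: maximum_matching_def order.strict_iff_order)
      moreover have "finite S" using SP(1) less.prems(1) by (meson finite_Diff finite_subset)
      then have "card (insert v S) = card S + 1"
        using SP(1) by (subst card_insert_disjoint) auto
      ultimately show ?thesis
        using SP v by (intro exI[of _ "insert v S"] exI[of _ P]) auto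
    next
      case False
      define R where "R = {(u, v). u \<in> V \<and> v \<in> V \<and>
        (u = v \<or> (\<forall>M. maximum_matching E M \<longrightarrow> u \<in> \<Union>M \<or> v \<in> \<Union>M))}"
      have "equiv V R"
      proof (rule equivI)
        show "R \<subseteq> V \<times> V" "refl_on V R" "sym R" by (auto simp: R_def refl_on_def sym_def)
        show "trans R"
        proof (rule transI)
          fix u t v assume *: "(u, t) \<in> R" "(t, v) \<in> R"
          show "(u, v) \<in> R"
          proof (cases "u = t \<or> t = v \<or> u = v")
            case True
            then show ?thesis using * by (auto simp: R_def)
          next
            case ne: False
            obtain N where N: "maximum_matching E N" "t \<notin> \<Union>N"
              using False * by (auto simp: R_def)
            have "u \<in> \<Union>M \<or> v \<in> \<Union>M" if "maximum_matching E M" for M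
              by (rule gallai_transitive[OF finE cardE(1) N]) (use * ne that in \<open>auto simp: R_def\<close>)
            then show ?thesis using * by (auto simp: R_def)
          qed
        qed
      qed
      define P where "P = V // R"
      have UP: "\<Union>P = V" using Union_quotient[OF \<open>equiv V R\<close>] by (simp add: P_def)
      have disjP: "pairwise disjnt P"
        using quotient_disj[OF \<open>equiv V R\<close>] by (auto simp: P_def pairwise_def disjnt_def)
      have inR: "(x, y) \<in> R" if "C \<in> P" "x \<in> C" "y \<in> C" for C x y
        using in_quotient_imp_in_rel[OF \<open>equiv V R\<close>, of C x y] that by (auto simp: P_def)
      have finP: "finite P"
        unfolding P_def by (rule finite_quotient) (use less.prems \<open>equiv V R\<close> equiv_type in auto)
      have finC: "finite C" if "C \<in> P" for C
        using that UP less.prems by (auto intro: finite_subset)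
      \<comment> \<open>A maximum matching missing both ends of an edge could be enlarged by it, so
        the ends of an edge are equivalent.\<close>
      have inside: "\<exists>C\<in>P. e \<subseteq> C" if e: "e \<in> E" for e
      proof -
        obtain x y where xy: "e = {x, y}" "x \<noteq> y" using cardE[OF e] by (auto simp: card_2_iff)
        have "x \<in> \<Union>M \<or> y \<in> \<Union>M" if M: "maximum_matching E M" for M
        proof (rule ccontr)
          assume *: "\<not> (x \<in> \<Union>M \<or> y \<in> \<Union>M)"
          have "is_matching E (insert e M)"
            using M e xy * by (auto simp: maximum_matching_def is_matching_def pairwise_insert disjnt_def)
          then have "card (insert e M) \<le> matching_number E" by (rule card_matching_le[OF finE])
          moreover have "finite M" using M finE finite_subset
            by (auto simp: maximum_matching_def is_matching_def)
          moreover have "e \<notin> M" using * xy by auto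
          ultimately show False using M by (simp add: maximum_matching_def)
        qed
        then have "(x, y) \<in> R" using cardE[OF e] xy by (auto simp: R_def)
        then have "e \<subseteq> R `` {x}"
          using xy cardE[OF e] by (auto simp: R_def)
        moreover have "R `` {x} \<in> P"
          unfolding P_def by (rule quotientI) (use xy cardE[OF e] in auto)
        ultimately show ?thesis by blast
      qed
      have cover: "card (C \<inter> \<Union>M) = 2 * card {e \<in> M. e \<subseteq> C}" if M: "maximum_matching E M" and C: "C \<in> P" for M C
      proof -
        have "C \<inter> \<Union>M = \<Union>{e \<in> M. e \<subseteq> C}"
        proof -
          have "e \<subseteq> C" if e: "e \<in> M" "x \<in> e" "x \<in> C" for e x
          proof -
            obtain D where D: "D \<in> P" "e \<subseteq> D"
              using inside[of e] M e(1) unfolding maximum_matching_def is_matching_def by blast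
            then have "D = C" using disjP C e by (auto simp: pairwise_def disjnt_def)
            then show ?thesis using D by simp
          qed
          then show ?thesis by blast
        qed
        moreover have "card (\<Union>{e \<in> M. e \<subseteq> C}) = 2 * card {e \<in> M. e \<subseteq> C}"
          by (rule card_Union_matching)
            (use M cardE in \<open>auto simp: maximum_matching_def is_matching_def pairwise_def\<close>)
        ultimately show ?thesis by simp
      qed
      have miss: "card (C - \<Union>M) \<le> 1" if M: "maximum_matching E M" and C: "C \<in> P" for M C
      proof -
        have "x = y" if "x \<in> C - \<Union>M" "y \<in> C - \<Union>M" for x y
          using inR[OF C, of x y] that M by (auto simp: R_def)
        then show ?thesis
          unfolding One_nat_def using finC[OF C] by (subst card_le_Suc0_iff_eq) auto
      qed
      have split: "card C = card (C \<inter> \<Union>M) + card (C - \<Union>M)" if "C \<in> P" for C M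
        using finC[OF that] card_Int_Diff by blast
      \<comment> \<open>Some maximum matching misses \<open>v\<close>; by \<open>miss\<close> it
        misses nothing else in \<open>C\<close>, and by \<open>cover\<close> it covers the rest of
        \<open>C\<close> in pairs.\<close>
      have "odd (card C)" if C: "C \<in> P" for C
      proof -
        obtain v where v: "v \<in> C"
          using in_quotient_imp_non_empty[OF \<open>equiv V R\<close>] C by (auto simp: P_def)
        then obtain M where M: "maximum_matching E M" "v \<notin> \<Union>M" using False C UP by blast
        have "card (C - \<Union>M) > 0" using v M finC[OF C] by (auto simp: card_gt_0_iff)
        then have "card (C - \<Union>M) = 1" using miss[OF M(1) C] by simp
        then show ?thesis using split[OF C, of M] cover[OF M(1) C] by simp
      qed
      moreover have "(\<Sum>C\<in>P. card C div 2) \<le> matching_number E"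
      proof -
        obtain M where "is_matching E M" "card M = matching_number E"
          using ex_maximum_matching finE by blast
        then have M: "maximum_matching E M" by (simp add: maximum_matching_def)
        have finM: "finite M" using M finE finite_subset
          by (auto simp: maximum_matching_def is_matching_def)
        have ne: "e \<noteq> {}" if "e \<in> M" for e
          using that M cardE(1)[of e] by (auto simp: maximum_matching_def is_matching_def)
        have "card C div 2 \<le> card {e \<in> M. e \<subseteq> C}" if "C \<in> P" for C
          using split[OF that, of M] miss[OF M that] cover[OF M that] by linarith
        then have "(\<Sum>C\<in>P. card C div 2) \<le> (\<Sum>C\<in>P. card {e \<in> M. e \<subseteq> C})" by (rule sum_mono)
        also have "\<dots> = card (\<Union>C\<in>P. {e \<in> M. e \<subseteq> C})"
        proof (rule card_UN_disjoint[symmetric])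
          show "\<forall>C\<in>P. \<forall>D\<in>P. C \<noteq> D \<longrightarrow> {e \<in> M. e \<subseteq> C} \<inter> {e \<in> M. e \<subseteq> D} = {}"
          proof (intro ballI impI equals0I)
            fix C D e assume *: "C \<in> P" "D \<in> P" "C \<noteq> D" "e \<in> {e \<in> M. e \<subseteq> C} \<inter> {e \<in> M. e \<subseteq> D}"
            then have "C \<inter> D = {}" using disjP by (auto simp: pairwise_def disjnt_def)
            then show False using * ne[of e] by blast
          qed
        qed (use finP finM in auto)
        also have "\<dots> \<le> card M" using finM by (intro card_mono) auto
        finally show ?thesis using M by (simp add: maximum_matching_def)
      qed
      ultimately show ?thesis
        using UP disjP inside by (intro exI[of _ "{}"] exI[of _ P]) auto
    qed
  qed
  then show ?thesis by (elim exE conjE) (rule that; blast)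
qed

section \<open>Counting edges\<close>

definition edges_in :: "'a set set \<Rightarrow> 'a set \<Rightarrow> 'a set set" where
  "edges_in E U = {e \<in> E. e \<subseteq> U}"

definition edges_meeting :: "'a set set \<Rightarrow> 'a set \<Rightarrow> 'a set set" where
  "edges_meeting E S = {e \<in> E. e \<inter> S \<noteq> {}}"

definition edges_between :: "'a set set \<Rightarrow> 'a set \<Rightarrow> 'a set \<Rightarrow> 'a set set" where
  "edges_between E A B = {e \<in> E. e \<inter> A \<noteq> {} \<and> e \<inter> B \<noteq> {}}"

definition vertex_degree :: "'a set set \<Rightarrow> 'a \<Rightarrow> nat" where
  "vertex_degree E v = card {e \<in> E. v \<in> e}"

lemma subset_Diff_eq: "e \<subseteq> V - T \<longleftrightarrow> e \<subseteq> V \<and> e \<inter> T = {}"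
  by auto

text \<open>The largest \<open>j\<close> values have at least the overall average; they are reached
  by discarding a minimal element repeatedly. The inequality is cross-multiplied to avoid
  division.\<close>

lemma card_subset_averaging:
  fixes f :: "'a \<Rightarrow> real"
  assumes "finite X" "j \<le> card X"
  obtains Y where "Y \<subseteq> X" "card Y = j" "real j * sum f X \<le> real (card X) * sum f Y"
proof -
  have "\<exists>Y\<subseteq>X. card Y = j \<and> real j * sum f X \<le> real (card X) * sum f Y"
    using assms
  proof (induction "card X - j" arbitrary: X)
    case 0
    then show ?case by (intro exI[of _ X]) auto
  next
    case (Suc d)
    then have pos: "card X > 0" and jX: "j < card X" by linarith+
    then have "X \<noteq> {}" by auto
    then obtain x where x: "x \<in> X" "\<And>y. y \<in> X \<Longrightarrow> f x \<le> f y"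
      using that[of "arg_min_on f X"] arg_min_if_finite[OF Suc.prems(1), of f] by (meson not_le)
    have cX: "card (X - {x}) = card X - 1" using x by simp
    have "d = card (X - {x}) - j" "j \<le> card (X - {x})" "finite (X - {x})"
      using Suc.hyps(2) Suc.prems jX cX by auto
    then obtain Y where Y: "Y \<subseteq> X - {x}" "card Y = j"
      "real j * sum f (X - {x}) \<le> real (card (X - {x})) * sum f Y"
      using Suc.hyps(1)[of "X - {x}"] by blast
    have "sum f X = f x + sum f (X - {x})" using x Suc.prems by (simp add: sum.remove)
    moreover have "real j * f x \<le> sum f Y"
      using sum_mono[of Y "\<lambda>_. f x" f] x Y by (auto simp: subset_iff)
    ultimately have "real j * sum f X \<le> sum f Y + (real (card X) - 1) * sum f Y"
      using Y(3) cX pos by (simp add: algebra_simps of_nat_diff)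
    then show ?case using Y by (intro exI[of _ Y]) (auto simp: algebra_simps)
  qed
  then show ?thesis using that by blast
qed

context
  fixes E :: "'a set set"
  assumes finE: "finite E" and card2: "\<And>e. e \<in> E \<Longrightarrow> card e = 2"
begin

lemma sum_card_incident:
  assumes "finite X" "finite F"
  shows "(\<Sum>x\<in>X. card {e \<in> F. x \<in> e}) = (\<Sum>e\<in>F. card (e \<inter> X))"
proof -
  have "(\<Sum>x\<in>X. card {e \<in> F. x \<in> e}) = (\<Sum>x\<in>X. \<Sum>e\<in>F. if x \<in> e then 1 else 0)"
    using assms by (intro sum.cong) (simp_all add: sum.If_cases Int_def)
  also have "\<dots> = (\<Sum>e\<in>F. \<Sum>x\<in>X. if x \<in> e then 1 else 0)" by (rule sum.swap)
  also have "\<dots> = (\<Sum>e\<in>F. card (e \<inter> X))"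
    using assms by (intro sum.cong) (simp_all add: sum.If_cases Int_def conj_commute)
  finally show ?thesis .
qed

lemma card_edges_between:
  assumes "finite A" "A \<inter> B = {}"
  shows "card (edges_between E A B) = (\<Sum>a\<in>A. card {e \<in> edges_between E A B. a \<in> e})"
proof -
  have "card (e \<inter> A) = 1" if e: "e \<in> edges_between E A B" for e
  proof -
    have "card e = 2" using e card2 by (simp add: edges_between_def)
    then obtain x y where "e = {x, y}" "x \<noteq> y" by (auto simp: card_2_iff)
    then have "\<exists>z. e \<inter> A = {z}"
      using e assms by (auto simp: edges_between_def)
    then show ?thesis by auto
  qed
  moreover have "finite (edges_between E A B)" using finE by (simp add: edges_between_def)
  ultimately show ?thesis using assms by (simp add: sum_card_incident)
qed

lemma edges_between_incident:
  assumes "X \<subseteq> A" "A \<inter> B = {}" "a \<in> X"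
  shows "{e \<in> edges_between E A B. a \<in> e} = {e \<in> edges_between E X B. a \<in> e}"
  using assms by (auto simp: edges_between_def)

text \<open>Averaging applied to the numbers of neighbours in \<open>B\<close>. The vertices moved
  in the comparison arguments are selected this way.\<close>

lemma edges_between_subset_averaging:
  assumes "finite A" "A \<inter> B = {}" "j \<le> card A"
  obtains X where "X \<subseteq> A" "card X = j"
    "j * card (edges_between E A B) \<le> card A * card (edges_between E X B)"
proof -
  define f where "f a = real (card {e \<in> edges_between E A B. a \<in> e})" for a
  obtain X where X: "X \<subseteq> A" "card X = j" "real j * sum f A \<le> real (card A) * sum f X"
    using card_subset_averaging[OF assms(1,3)] by metis
  have "sum f A = real (card (edges_between E A B))"
    using card_edges_between[OF assms(1,2)] by (simp add: f_def)
  moreover have "sum f X = real (card (edges_between E X B))"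
  proof -
    have "finite X" "X \<inter> B = {}" using X assms finite_subset by auto
    then show ?thesis
      using card_edges_between[of X B] edges_between_incident[OF X(1) assms(2)] by (simp add: f_def)
  qed
  ultimately have "real (j * card (edges_between E A B)) \<le> real (card A * card (edges_between E X B))"
    using X(3) by simp
  then have "j * card (edges_between E A B) \<le> card A * card (edges_between E X B)"
    by (simp only: of_nat_le_iff)
  then show ?thesis using that X by blast
qed

text \<open>Deleting a vertex of at least average degree does not increase the density, that is, the
  number of edges divided by \<open>card U * (card U - 1)\<close>. This is repeated until
  \<open>b\<close> vertices are left.\<close>

lemma ex_sparse_subset:
  assumes "finite U" "b \<le> card U"
  obtains B where "B \<subseteq> U" "card B = b"
    "real (card (edges_in E B)) * (real (card U) * (real (card U) - 1))
      \<le> real (card (edges_in E U)) * (real b * (real b - 1))"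
proof -
  have "\<exists>B\<subseteq>U. card B = b \<and> real (card (edges_in E B)) * (real (card U) * (real (card U) - 1))
      \<le> real (card (edges_in E U)) * (real b * (real b - 1))"
    using assms
  proof (induction "card U - b" arbitrary: U)
    case 0
    then show ?case by (intro exI[of _ U]) auto
  next
    case (Suc d)
    then have bU: "b < card U" by linarith
    let ?u = "real (card U)"
    define f where "f x = real (card {e \<in> edges_in E U. x \<in> e})" for x
    have fin: "finite (edges_in E U)" using finE by (simp add: edges_in_def)
    have "e \<inter> U = e" if "e \<in> edges_in E U" for e using that by (auto simp: edges_in_def)
    then have "card (e \<inter> U) = 2" if "e \<in> edges_in E U" for e
      using that card2 by (simp add: edges_in_def)
    then have "(\<Sum>x\<in>U. card {e \<in> edges_in E U. x \<in> e}) = 2 * card (edges_in E U)"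
      using sum_card_incident[OF Suc.prems(1) fin] by simp
    then have sumf: "sum f U = 2 * real (card (edges_in E U))"
      unfolding f_def by (metis of_nat_mult of_nat_numeral of_nat_sum)
    obtain X where X: "X \<subseteq> U" "card X = 1" "1 * sum f U \<le> ?u * sum f X"
      using card_subset_averaging[OF Suc.prems(1), of 1 f] bU by auto
    then obtain v where v: "X = {v}" by (auto simp: card_1_singleton_iff)
    have vU: "v \<in> U" using X v by auto
    have "edges_in E U = edges_in E (U - {v}) \<union> {e \<in> edges_in E U. v \<in> e}"
      "edges_in E (U - {v}) \<inter> {e \<in> edges_in E U. v \<in> e} = {}" by (auto simp: edges_in_def)
    then have "card (edges_in E U) = card (edges_in E (U - {v})) + card {e \<in> edges_in E U. v \<in> e}"
      using fin by (metis (no_types, lifting) card_Un_disjoint finite_Un)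
    \<comment> \<open>The deleted vertex lies on at least the fraction \<open>2 / ?u\<close> of the
      edges, so at most the fraction \<open>1 - 2 / ?u\<close> survives.\<close>
    then have step: "?u * real (card (edges_in E (U - {v}))) \<le> (?u - 2) * real (card (edges_in E U))"
      using X(3) v sumf by (simp add: f_def algebra_simps)
    have cU: "card (U - {v}) = card U - 1" using vU by simp
    have "d = card (U - {v}) - b" "b \<le> card (U - {v})"
      using Suc.hyps(2) bU cU by auto
    then obtain B where B: "B \<subseteq> U - {v}" "card B = b"
      "real (card (edges_in E B)) * (real (card (U - {v})) * (real (card (U - {v})) - 1))
        \<le> real (card (edges_in E (U - {v}))) * (real b * (real b - 1))"
      using Suc.hyps(1)[of "U - {v}"] \<open>d = card (U - {v}) - b\<close> \<open>b \<le> card (U - {v})\<close> Suc.prems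
      by blast
    have rc: "real (card (U - {v})) = ?u - 1" using cU bU by (simp add: of_nat_diff)
    have b0: "real b * (real b - 1) \<ge> 0" by (cases b) auto
    have "real (card (edges_in E B)) * (?u * (?u - 1)) \<le> real (card (edges_in E U)) * (real b * (real b - 1))"
    \<comment> \<open>The general case cancels the factor \<open>?u - 2\<close>, which has to be
      positive. For at most two vertices, \<open>B\<close> has at most one and so spans no
      edge.\<close>
    proof (cases "card U \<le> 2")
      case True
      then have "b \<le> 1" using bU by linarith
      moreover have "2 \<le> card B" if "e \<in> edges_in E B" for e
        using that card2[of e] card_mono[of B e] finite_subset[OF B(1)] Suc.prems(1)
        by (auto simp: edges_in_def)
      ultimately have "edges_in E B = {}" using B(2) by fastforce
      then show ?thesis using b0 by simp
    next
      case False
      have "(?u - 2) * (real (card (edges_in E B)) * (?u * (?u - 1)))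
          = ?u * (real (card (edges_in E B)) * ((?u - 1) * (?u - 2)))" by (simp add: algebra_simps)
      also have "\<dots> \<le> ?u * (real (card (edges_in E (U - {v}))) * (real b * (real b - 1)))"
        using B(3) rc by (intro mult_left_mono) auto
      also have "\<dots> \<le> (?u - 2) * real (card (edges_in E U)) * (real b * (real b - 1))"
        using mult_right_mono[OF step b0] by (simp add: mult.assoc)
      finally show ?thesis using False by (simp add: mult.assoc)
    qed
    then show ?case using B by (intro exI[of _ B]) auto
  qed
  then show ?thesis using that by blast
qed

text \<open>An edge meeting \<open>T\<close> has at most one end in \<open>R\<close>; an edge
  avoiding \<open>T\<close> has at most two and lies in \<open>V - T\<close>. This turns a minimum
  degree into a lower bound on the edges leaving a sparse set.\<close>

lemma sum_degree_le:
  assumes "finite V" "\<And>e. e \<in> E \<Longrightarrow> e \<subseteq> V" "R \<subseteq> V" "T \<subseteq> V" "R \<inter> T = {}"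
  shows "(\<Sum>v\<in>R. vertex_degree E v) \<le> card (edges_between E R T) + 2 * card (edges_in E (V - T))"
proof -
  have finR: "finite R" using assms finite_subset by blast
  have "(\<Sum>v\<in>R. vertex_degree E v) = (\<Sum>e\<in>E. card (e \<inter> R))"
    unfolding vertex_degree_def by (rule sum_card_incident[OF finR finE])
  also have "\<dots> \<le> (\<Sum>e\<in>E. (if e \<in> edges_between E R T then 1 else 0) + (if e \<in> edges_in E (V - T) then 2 else 0))"
  proof (rule sum_mono)
    fix e assume e: "e \<in> E"
    then obtain x y where xy: "e = {x, y}" "x \<noteq> y" using card2[of e] by (auto simp: card_2_iff)
    have "card (e \<inter> R) \<le> 2" using card_mono[of e "e \<inter> R"] card2[OF e] e by (auto simp: xy)
    moreover have "card (e \<inter> R) \<le> 1" if "e \<inter> T \<noteq> {}"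
    proof -
      have "e \<inter> R \<subseteq> {x} \<or> e \<inter> R \<subseteq> {y}" using that xy assms(5) by auto
      then show ?thesis using card_mono[of "{x}" "e \<inter> R"] card_mono[of "{y}" "e \<inter> R"] by auto
    qed
    moreover have "card (e \<inter> R) = 0" if "e \<inter> R = {}" using that by simp
    moreover have "e \<subseteq> V" using e assms by simp
    ultimately show "card (e \<inter> R) \<le> (if e \<in> edges_between E R T then 1 else 0) + (if e \<in> edges_in E (V - T) then 2 else 0)"
      using e by (cases "e \<inter> T = {}"; cases "e \<inter> R = {}")
        (simp_all add: edges_between_def edges_in_def subset_Diff_eq)
  qed
  also have "\<dots> = card (edges_between E R T) + 2 * card (edges_in E (V - T))"
  proof -
    have "E \<inter> edges_between E R T = edges_between E R T" "E \<inter> edges_in E (V - T) = edges_in E (V - T)"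
      by (auto simp: edges_between_def edges_in_def)
    then show ?thesis using finE by (simp add: sum.distrib sum.If_cases)
  qed
  finally show ?thesis .
qed

end

lemma edges_between_subset_Un:
  assumes "e \<in> edges_between E A B" "card e = 2" "A \<inter> B = {}"
  shows "e \<subseteq> A \<union> B"
  using assms by (auto simp: edges_between_def card_2_iff)

text \<open>
  This is chosen as a function of the edges outside \<open>S\<close> alone, which makes it independent of the
  random edges meeting \<open>S\<close>.
\<close>

definition light_set :: "'a set set \<Rightarrow> 'a set \<Rightarrow> 'a set \<Rightarrow> nat \<Rightarrow> 'a set" where
  "light_set E V S w =
    arg_min (\<lambda>W. card (edges_meeting (edges_in E (V - S)) W)) (\<lambda>W. W \<subseteq> V - S \<and> card W = w)"

text \<open>The set \<open>W\<close> shows that the minimum is over a nonempty family, and then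
  serves as a competitor of the minimiser.\<close>

lemma light_set:
  assumes "W \<subseteq> V - S" "card W = w"
  shows "light_set E V S w \<subseteq> V - S" "card (light_set E V S w) = w"
    "card (edges_meeting (edges_in E (V - S)) (light_set E V S w))
      \<le> card (edges_meeting (edges_in E (V - S)) W)"
  using arg_min_nat_lemma[where P = "\<lambda>W. W \<subseteq> V - S \<and> card W = w" and k = W
      and m = "\<lambda>W. card (edges_meeting (edges_in E (V - S)) W)"] assms
  unfolding light_set_def[symmetric] by blast+

section \<open>Largest subgraphs of pseudorandom graphs\<close>

text \<open>
  In the last assumption, \<open>22 / 100 = 1 / 4 - 3 / 100\<close> and \<open>75 / 100 < 99 / 100 * (1 - 215 / 1000)\<close>
  are the average numbers of neighbours outside \<open>W\<close>, in units of \<open>card V * p\<close>, that the other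
  assumptions guarantee for the vertices of a set \<open>W\<close> of size at most \<open>215 / 1000 * card V\<close>.
\<close>

locale pseudorandom =
  fixes V :: "'a set" and E :: "'a set set" and p \<gamma> :: real
  assumes finite_V: "finite V" and edges: "E \<subseteq> complete_edges V"
    and p_pos: "p > 0" and gamma: "0 < \<gamma>" "\<gamma> \<le> 1 / 100" and large: "card V \<ge> 1000"
    and small_sparse: "\<And>C. C \<subseteq> V \<Longrightarrow> 2 \<le> card C \<Longrightarrow> card C \<le> \<gamma> * card V \<Longrightarrow>
      card (edges_in E C) \<le> (real (card C) - 1) / 2 * (3 / 100 * card V * p)"
    and dense_lower: "\<And>U. U \<subseteq> V \<Longrightarrow> \<gamma> * card V \<le> card U \<Longrightarrow>
      99 / 100 * (p * (card U * (real (card U) - 1) / 2)) \<le> card (edges_in E U)"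
    and dense_upper: "\<And>U. U \<subseteq> V \<Longrightarrow> \<gamma> * card V \<le> card U \<Longrightarrow>
      card (edges_in E U) \<le> 101 / 100 * (p * (card U * (real (card U) - 1) / 2))"
    and between_lower: "\<And>A B. A \<subseteq> V \<Longrightarrow> B \<subseteq> V \<Longrightarrow> A \<inter> B = {} \<Longrightarrow>
      \<gamma> / 2 * card V \<le> card A \<Longrightarrow> \<gamma> / 2 * card V \<le> card B \<Longrightarrow>
      99 / 100 * (p * (card A * card B)) \<le> card (edges_between E A B)"
    and min_degree: "\<And>v. v \<in> V \<Longrightarrow> card V * p / 4 \<le> vertex_degree E v"
    and light_set_sparse: "\<And>S w. S \<subseteq> V \<Longrightarrow> S \<noteq> {} \<Longrightarrow> w \<le> card (V - S) \<Longrightarrow> w \<le> 22 / 100 * card V \<Longrightarrow>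
      card (edges_between E S (light_set E V S w))
        < card S * (card V * p * (if w < \<gamma> / 2 * card V then 22 / 100 else 75 / 100))"
begin

lemma finite_E: "finite E"
  using edges finite_V finite_complete_edges finite_subset by blast

lemma card_edge: "e \<in> E \<Longrightarrow> card e = 2" and edge_subset: "e \<in> E \<Longrightarrow> e \<subseteq> V"
  using edges by (auto simp: complete_edges_def)

lemma edges_in_small: "finite C \<Longrightarrow> card C \<le> 1 \<Longrightarrow> edges_in E C = {}"
proof (rule ccontr)
  assume C: "finite C" "card C \<le> 1" "edges_in E C \<noteq> {}"
  then obtain e where "e \<in> E" "e \<subseteq> C" by (auto simp: edges_in_def)
  then show False using card_edge[of e] card_mono[of C e] C by auto
qed

text \<open>The maximum merges the sparse and the dense regime. For an odd part the factor
  \<open>(card C - 1) / 2\<close> is its contribution to \<open>k\<close>, so the bounds for several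
  parts add up to a multiple of their total contribution.\<close>

lemma edges_in_le:
  assumes "C \<subseteq> V" "1 \<le> card C" "card C \<le> c"
  shows "card (edges_in E C) \<le> p * ((real (card C) - 1) / 2) * max (101 / 100 * c) (3 / 100 * card V)"
proof -
  have finC: "finite C" using assms finite_V finite_subset by blast
  let ?M = "max (101 / 100 * real c) (3 / 100 * card V)"
  consider "card C = 1" | "2 \<le> card C" "card C \<le> \<gamma> * card V" | "\<gamma> * card V \<le> card C"
    using assms(2) by linarith
  then show ?thesis
  proof cases
    case 1
    then show ?thesis using edges_in_small[OF finC] by simp
  next
    case 2
    have "card (edges_in E C) \<le> (real (card C) - 1) / 2 * p * (3 / 100 * card V)"
      using small_sparse[OF assms(1) 2] by (simp add: algebra_simps)
    also have "\<dots> \<le> (real (card C) - 1) / 2 * p * ?M"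
      using 2 p_pos by (intro mult_left_mono) auto
    finally show ?thesis by (simp add: algebra_simps)
  next
    case 3
    have "card (edges_in E C) \<le> (real (card C) - 1) / 2 * p * (101 / 100 * card C)"
      using dense_upper[OF assms(1) 3] by (simp add: algebra_simps)
    also have "\<dots> \<le> (real (card C) - 1) / 2 * p * ?M"
      using assms p_pos by (intro mult_left_mono) auto
    finally show ?thesis by (simp add: algebra_simps)
  qed
qed

end

section \<open>Competitors of a largest subgraph\<close>

locale largest_subgraph = pseudorandom +
  fixes k :: nat and H :: "'a set set"
  assumes largest: "largest_subgraph_with_matching_number E k H"
    and k_le: "k \<le> matching_number E" and k_lt: "2 * k + 1 \<le> card V"
begin

text \<open>All comparisons use competitors of this shape: the easy direction of Tutte--Berge bounds
  their matching number by \<open>k\<close>.\<close>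

lemma H_ge:
  assumes "T \<subseteq> V" "finite Q" "\<And>C. C \<in> Q \<Longrightarrow> C \<subseteq> V" "card T + (\<Sum>C\<in>Q. card C div 2) \<le> k"
  shows "card {e \<in> E. e \<inter> T \<noteq> {} \<or> (\<exists>C\<in>Q. e \<subseteq> C)} \<le> card H"
proof (rule largest_subgraph_ge[OF finite_E largest k_le])
  have "matching_number {e \<in> E. e \<inter> T \<noteq> {} \<or> (\<exists>C\<in>Q. e \<subseteq> C)} \<le> card T + (\<Sum>C\<in>Q. card C div 2)"
    by (rule matching_number_le_cover)
      (use assms finite_V finite_E card_edge in \<open>auto intro: finite_subset\<close>)
  then show "matching_number {e \<in> E. e \<inter> T \<noteq> {} \<or> (\<exists>C\<in>Q. e \<subseteq> C)} \<le> k" using assms(4) by simp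
qed auto

lemma card_edges_meeting: "card (edges_meeting E S) + card (edges_in E (V - S)) = card E"
proof -
  have "E = edges_meeting E S \<union> edges_in E (V - S)" "edges_meeting E S \<inter> edges_in E (V - S) = {}"
    using edge_subset by (auto simp: edges_meeting_def edges_in_def)
  then show ?thesis using finite_E by (metis card_Un_disjoint finite_Un)
qed

end

section \<open>The Tutte--Berge partition of a largest subgraph\<close>

locale largest_subgraph_partition = largest_subgraph +
  fixes S :: "'a set" and P :: "'a set set"
  assumes S_subset: "S \<subseteq> V" and Union_P: "\<Union>P = V - S" and disjoint_P: "pairwise disjnt P"
    and odd_P: "\<And>C. C \<in> P \<Longrightarrow> odd (card C)"
    and H_eq: "H = {e \<in> E. e \<inter> S \<noteq> {} \<or> (\<exists>C\<in>P. e \<subseteq> C)}"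
    and k_eq: "card S + (\<Sum>C\<in>P. card C div 2) = k"
begin

lemma finite_P: "finite P"
  using Union_P finite_V by (metis finite_Diff finite_UnionD)

lemma part_subset: "C \<in> P \<Longrightarrow> C \<subseteq> V - S"
  using Union_P by blast

lemma finite_part: "C \<in> P \<Longrightarrow> finite C"
  using part_subset finite_V by (meson finite_Diff finite_subset)

lemma finite_S: "finite S"
  using S_subset finite_V finite_subset by blast

lemma card_part: "C \<in> P \<Longrightarrow> card C = 2 * (card C div 2) + 1"
  using odd_P by (metis odd_two_times_div_two_succ)

lemma sum_card_parts: "Q \<subseteq> P \<Longrightarrow> card (\<Union>Q) = 2 * (\<Sum>C\<in>Q. card C div 2) + card Q"
proof -
  assume Q: "Q \<subseteq> P"
  have "card (\<Union>Q) = (\<Sum>C\<in>Q. card C)"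
    using Q disjoint_P finite_part by (intro card_Union_disjoint) (auto simp: pairwise_def)
  also have "\<dots> = (\<Sum>C\<in>Q. 2 * (card C div 2) + 1)"
    using Q card_part by (intro sum.cong) auto
  also have "\<dots> = 2 * (\<Sum>C\<in>Q. card C div 2) + card Q"
    unfolding sum.distrib sum_distrib_left by simp
  finally show ?thesis .
qed

lemma card_U: "card (V - S) = 2 * (k - card S) + card P"
  using sum_card_parts[of P] Union_P k_eq by simp

lemma card_S_U: "card S + card (V - S) = card V"
  using card_Diff_subset[OF finite_S S_subset] card_mono[OF finite_V S_subset] by simp

text \<open>By \<open>card_U\<close>, \<open>card V = 2 * k - card S + card P\<close>, and
  \<open>k_lt\<close> makes this at least \<open>2 * k + 1\<close>. The surplus of parts over
  \<open>S\<close> later ensures that outside a giant part there are at least \<open>card S\<close>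
  vertices.\<close>

lemma card_S_lt: "card S + 1 \<le> card P"
  using card_U card_S_U k_lt k_eq by linarith

lemma U_large: "card V + 1 \<le> 2 * card (V - S)"
  using card_S_lt card_U card_S_U by linarith

lemma card_parts_edges:
  assumes "Q \<subseteq> P" "\<And>C. C \<in> Q \<Longrightarrow> card C \<le> c"
  shows "(\<Sum>C\<in>Q. card (edges_in E C))
    \<le> p * (\<Sum>C\<in>Q. card C div 2) * max (101 / 100 * c) (3 / 100 * card V)"
proof -
  let ?M = "max (101 / 100 * real c) (3 / 100 * card V)"
  have "real (card (edges_in E C)) \<le> p * real (card C div 2) * ?M" if "C \<in> Q" for C
  proof -
    have CP: "C \<in> P" using that assms by auto
    have "real (card C) = 2 * real (card C div 2) + 1"
      using card_part[OF CP] by (metis of_nat_1 of_nat_add of_nat_mult of_nat_numeral)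
    moreover have "card (edges_in E C) \<le> p * ((real (card C) - 1) / 2) * ?M"
      using part_subset[OF CP] card_part[OF CP] assms that by (intro edges_in_le) auto
    ultimately show ?thesis by simp
  qed
  then have "(\<Sum>C\<in>Q. real (card (edges_in E C))) \<le> (\<Sum>C\<in>Q. p * real (card C div 2) * ?M)"
    by (rule sum_mono)
  then show ?thesis by (simp add: sum_distrib_left sum_distrib_right)
qed

text \<open>Compares \<open>H\<close> with the edges meeting \<open>S\<close> or a suitable set of \<open>k - card S\<close> further vertices.\<close>

lemma largest_part_bound:
  assumes "card S < k" "\<And>C. C \<in> P \<Longrightarrow> card C \<le> c"
  shows "99 / 100 * (2 * card (V - S) - (real k - card S) - 1) / 2
    \<le> max (101 / 100 * c) (3 / 100 * card V)"
proof -
  let ?U = "V - S" and ?M = "max (101 / 100 * real c) (3 / 100 * card V)"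
  define a where "a = k - card S"
  have a: "a \<ge> 1" "real a = real k - card S" using assms(1) by (auto simp: a_def)
  have a_le: "2 * a \<le> card ?U" using card_U by (simp add: a_def)
  \<comment> \<open>The complement of \<open>B\<close> is \<open>S\<close> together with
    \<open>a\<close> further vertices, \<open>k\<close> in all, so the edges meeting it form a
    competitor. It misses only the edges inside \<open>B\<close>, which are few because
    \<open>B\<close> is sparse.\<close>
  obtain B where B: "B \<subseteq> ?U" "card B = card ?U - a"
    "real (card (edges_in E B)) * (real (card ?U) * (real (card ?U) - 1))
      \<le> real (card (edges_in E ?U)) * (real (card ?U - a) * (real (card ?U - a) - 1))"
    using ex_sparse_subset[OF finite_E card_edge, of ?U "card ?U - a"] finite_V
    by (metis diff_le_self finite_Diff)
  have "card (V - B) = card V - card B"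
    using B(1) finite_V by (intro card_Diff_subset) (auto intro: finite_subset)
  then have "card (V - B) = k" using B(2) card_S_U a_le assms(1) by (simp add: a_def)
  then have "card {e \<in> E. e \<inter> (V - B) \<noteq> {} \<or> (\<exists>C\<in>{}. e \<subseteq> C)} \<le> card H"
    by (intro H_ge) auto
  then have "card (edges_meeting E (V - B)) \<le> card H" by (simp add: edges_meeting_def)
  moreover have "V - (V - B) = B" using B(1) by auto
  ultimately have 1: "card E \<le> card H + card (edges_in E B)"
    using card_edges_meeting[of "V - B"] by simp
  have "H = edges_meeting E S \<union> (\<Union>C\<in>P. edges_in E C)"
    unfolding H_eq by (auto simp: edges_meeting_def edges_in_def)
  then have "card H \<le> card (edges_meeting E S) + (\<Sum>C\<in>P. card (edges_in E C))"
    using card_Un_le card_UN_le[OF finite_P, of "edges_in E"] by (metis add_left_mono order_trans)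
  then have "card (edges_in E ?U) \<le> card (edges_in E B) + (\<Sum>C\<in>P. card (edges_in E C))"
    using 1 card_edges_meeting[of S] by linarith
  moreover have "(\<Sum>C\<in>P. real (card C div 2)) = real a"
    using k_eq by (simp add: a_def flip: of_nat_sum)
  then have "(\<Sum>C\<in>P. card (edges_in E C)) \<le> p * a * ?M"
    using card_parts_edges[of P c] assms(2) by simp
  ultimately have 2: "real (card (edges_in E ?U)) \<le> real (card (edges_in E B)) + p * a * ?M"
    by linarith
  define u where "u = real (card ?U)"
  have u: "u \<ge> 2" using U_large large by (simp add: u_def)
  have ru: "real (card ?U - a) = u - a" using a_le by (simp add: u_def of_nat_diff)
  have "\<gamma> * card V \<le> 1 / 100 * card V" using gamma by (intro mult_right_mono) auto
  then have "\<gamma> * card V \<le> card ?U" using U_large by linarith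
  then have 3: "99 / 100 * (p * (u * (u - 1) / 2)) \<le> card (edges_in E ?U)"
    using dense_lower[of ?U] by (simp add: u_def)
  have 4: "real (card (edges_in E B)) * (u * (u - 1)) \<le> card (edges_in E ?U) * ((u - a) * (u - a - 1))"
    using B(3) unfolding ru u_def[symmetric] by simp
  have uu: "u * (u - 1) > 0" using u by simp
  have "card (edges_in E ?U) * (u * (u - 1)) \<le> (real (card (edges_in E B)) + p * a * ?M) * (u * (u - 1))"
    using 2 uu by (intro mult_right_mono) auto
  also have "\<dots> \<le> card (edges_in E ?U) * ((u - a) * (u - a - 1)) + p * a * ?M * (u * (u - 1))"
    using 4 by (simp add: distrib_right)
  \<comment> \<open>Here
    \<open>u * (u - 1) - (u - a) * (u - a - 1) = a * (2 * u - a - 1)\<close>.\<close>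
  finally have "card (edges_in E ?U) * (a * (2 * u - a - 1)) \<le> p * a * ?M * (u * (u - 1))"
    by (simp add: algebra_simps)
  moreover have "99 / 100 * (p * (u * (u - 1) / 2)) * (a * (2 * u - a - 1))
      \<le> card (edges_in E ?U) * (a * (2 * u - a - 1))"
    using 3 a_le u by (intro mult_right_mono) (auto simp: u_def)
  ultimately have "99 / 100 * (p * (u * (u - 1) / 2)) * (a * (2 * u - a - 1)) \<le> p * a * ?M * (u * (u - 1))"
    by linarith
  then have "(p * a * (u * (u - 1))) * (99 / 100 * (2 * u - a - 1) / 2) \<le> (p * a * (u * (u - 1))) * ?M"
    by (simp add: algebra_simps)
  moreover have "p * a * (u * (u - 1)) > 0" using p_pos a uu by simp
  ultimately have "99 / 100 * (2 * u - a - 1) / 2 \<le> ?M" by (simp only: mult_le_cancel_left_pos)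
  then show ?thesis unfolding u_def a(2) by simp
qed

end

context largest_subgraph_partition
begin

text \<open>Since \<open>k - card S\<close> is less than half of \<open>card (V - S)\<close>, the
  left side of \<open>largest_part_bound\<close> is at least about
  \<open>74 / 100 * card (V - S)\<close>. This exceeds the sparse alternative
  \<open>3 / 100 * card V\<close>, so the largest part is a giant. The last conclusion keeps the
  dependence on \<open>k\<close>, which gives a better constant once the other parts are known to be
  trivial.\<close>

lemma ex_giant_part:
  assumes "card S < k"
  obtains C where "C \<in> P" "\<And>D. D \<in> P \<Longrightarrow> card D \<le> card C"
    "73 / 100 * card (V - S) \<le> card C"
    "99 * (2 * real (card (V - S)) - (real k - card S) - 1) / 2 \<le> 101 * card C"
proof -
  have "P \<noteq> {}" using card_S_lt by auto
  then have "Max (card ` P) \<in> card ` P" using finite_P by (intro Max_in) auto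
  then obtain C where C: "C \<in> P" "card C = Max (card ` P)" by auto
  have Cmax: "card D \<le> card C" if "D \<in> P" for D
    using that finite_P C(2) by simp
  have *: "99 / 100 * (2 * card (V - S) - (real k - card S) - 1) / 2
      \<le> max (101 / 100 * card C) (3 / 100 * card V)"
    using largest_part_bound[OF assms Cmax] .
  have ka: "real k - card S \<le> (real (card (V - S)) - 1) / 2"
  proof -
    have "2 * k + 1 \<le> 2 * card S + card (V - S)" using card_U card_S_lt k_eq by linarith
    then have "real (2 * k + 1) \<le> real (2 * card S + card (V - S))" by (rule of_nat_mono)
    then show ?thesis by simp
  qed
  have n: "real (card V) + 1 \<le> 2 * card (V - S)" "real (card V) \<ge> 1000"
    using U_large large by linarith+
  have "99 / 100 * (2 * card (V - S) - (real k - card S) - 1) / 2 > 3 / 100 * card V"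
    using ka n by (simp add: field_simps)
  then have c: "99 / 100 * (2 * card (V - S) - (real k - card S) - 1) / 2 \<le> 101 / 100 * card C"
    using * by linarith
  then have "73 / 100 * card (V - S) \<le> card C"
    using ka n by (simp add: field_simps)
  moreover have "99 * (2 * real (card (V - S)) - (real k - card S) - 1) / 2 \<le> 101 * card C"
    using c by (simp add: field_simps)
  ultimately show ?thesis using that C(1) Cmax by blast
qed

text \<open>The competitor dissolves the other parts and adds \<open>2 * b\<close> of their vertices
  to \<open>C\<close>. It gains the edges from these vertices to \<open>C\<close> and loses only the
  edges inside the other parts, which are too few to compensate.\<close>

lemma other_parts_trivial:
  assumes C: "C \<in> P" "73 / 100 * card (V - S) \<le> card C"
  shows "(\<Sum>D\<in>P - {C}. card D div 2) = 0"
proof (rule ccontr)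
  define b where "b = (\<Sum>D\<in>P - {C}. card D div 2)"
  assume "(\<Sum>D\<in>P - {C}. card D div 2) \<noteq> 0"
  then have b: "b \<ge> 1" by (simp add: b_def)
  define R where "R = V - S - C"
  have CV: "C \<subseteq> V - S" "finite C" using part_subset C finite_part by auto
  have UR: "\<Union>(P - {C}) = R"
    using Union_P C disjoint_P by (auto simp: R_def pairwise_def disjnt_def)
  have r: "card R = 2 * b + card (P - {C})"
    using sum_card_parts[of "P - {C}"] UR by (auto simp: b_def)
  have ur: "card (V - S) = card C + card R"
    using CV finite_V card_mono[OF _ CV(1)] by (simp add: R_def card_Diff_subset)
  have cP: "card (P - {C}) = card P - 1" using C by simp
  have sr: "card S \<le> card R" using card_S_lt cP r by linarith
  have "P - {C} \<noteq> {}" using b unfolding b_def by (metis not_one_le_zero sum.empty)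
  then have "card (P - {C}) \<ge> 1" using finite_P by (simp add: Suc_le_eq card_gt_0_iff)
  then have r3: "card R \<ge> 3" using r b by linarith
  have finR: "finite R" using finite_V by (simp add: R_def)
  have RC: "R \<inter> C = {}" by (auto simp: R_def)
  have RV: "R \<subseteq> V" by (auto simp: R_def)
  \<comment> \<open>Adding \<open>2 * b\<close> vertices to \<open>C\<close> raises
    \<open>card C div 2\<close> by \<open>b\<close>, exactly the contribution to \<open>k\<close>
    released by the other parts.\<close>
  obtain X where X: "X \<subseteq> R" "card X = 2 * b"
    "2 * b * card (edges_between E R C) \<le> card R * card (edges_between E X C)"
    using edges_between_subset_averaging[OF finite_E card_edge finR RC, of "2 * b"] r by auto
  have XC: "X \<inter> C = {}" "finite X" using X RC finR finite_subset by auto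
  have k: "k = card S + card C div 2 + b"
    using k_eq C finite_P by (simp add: b_def sum.remove)
  have "card (C \<union> X) = card C + 2 * b" using XC CV X by (subst card_Un_disjoint) auto
  then have "card {e \<in> E. e \<inter> S \<noteq> {} \<or> (\<exists>D\<in>{C \<union> X}. e \<subseteq> D)} \<le> card H"
    using S_subset CV X RV k by (intro H_ge) auto
  moreover have "edges_meeting E S \<union> (edges_in E C \<union> edges_between E X C)
      \<subseteq> {e \<in> E. e \<inter> S \<noteq> {} \<or> (\<exists>D\<in>{C \<union> X}. e \<subseteq> D)}"
    using edges_between_subset_Un[OF _ card_edge XC(1)]
    by (auto simp: edges_meeting_def edges_in_def edges_between_def)
  moreover have "card (edges_meeting E S \<union> (edges_in E C \<union> edges_between E X C))
      = card (edges_meeting E S) + (card (edges_in E C) + card (edges_between E X C))"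
  proof -
    have fin: "finite (edges_meeting E S)" "finite (edges_in E C)" "finite (edges_between E X C)"
      using finite_E by (auto simp: edges_meeting_def edges_in_def edges_between_def)
    have 1: "edges_in E C \<inter> edges_between E X C = {}"
      using XC by (auto simp: edges_in_def edges_between_def)
    have "e \<subseteq> V - S" if "e \<in> edges_between E X C" for e
    proof -
      have "e \<subseteq> X \<union> C"
        using edges_between_subset_Un[OF that _ XC(1)] card_edge that by (auto simp: edges_between_def)
      then show ?thesis using X(1) CV by (auto simp: R_def)
    qed
    then have 2: "edges_meeting E S \<inter> (edges_in E C \<union> edges_between E X C) = {}"
      using CV by (fastforce simp: edges_meeting_def edges_in_def)
    show ?thesis using fin 1 2 by (simp add: card_Un_disjoint)
  qed
  moreover have "finite {e \<in> E. e \<inter> S \<noteq> {} \<or> (\<exists>D\<in>{C \<union> X}. e \<subseteq> D)}" using finite_E by simp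
  ultimately have low: "card (edges_meeting E S) + (card (edges_in E C) + card (edges_between E X C)) \<le> card H"
    using card_mono by (metis (no_types, lifting) order_trans)
  have "H = edges_meeting E S \<union> (edges_in E C \<union> (\<Union>D\<in>P - {C}. edges_in E D))"
    unfolding H_eq using C by (auto simp: edges_meeting_def edges_in_def)
  then have "card H \<le> card (edges_meeting E S) + (card (edges_in E C) + card (\<Union>D\<in>P - {C}. edges_in E D))"
    by (metis add_left_mono card_Un_le order_trans)
  moreover have "card (\<Union>D\<in>P - {C}. edges_in E D) \<le> (\<Sum>D\<in>P - {C}. card (edges_in E D))"
    by (rule card_UN_le) (simp add: finite_P)
  ultimately have "card (edges_between E X C) \<le> (\<Sum>D\<in>P - {C}. card (edges_in E D))"
    using low by linarith
  then have "real (card (edges_between E X C)) \<le> (\<Sum>D\<in>P - {C}. real (card (edges_in E D)))"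
    by (simp flip: of_nat_sum)
  moreover have "(\<Sum>D\<in>P - {C}. card (edges_in E D))
      \<le> p * (\<Sum>D\<in>P - {C}. card D div 2) * max (101 / 100 * card R) (3 / 100 * card V)"
    by (rule card_parts_edges) (use UR finR in \<open>auto intro: card_mono\<close>)
  moreover have "(\<Sum>D\<in>P - {C}. real (card D div 2)) = real b"
    by (simp add: b_def flip: of_nat_sum)
  ultimately have XCle: "real (card (edges_between E X C))
      \<le> p * b * max (101 / 100 * card R) (3 / 100 * card V)"
    by simp
  have "real (2 * b * card (edges_between E R C)) \<le> real (card R * card (edges_between E X C))"
    using X(3) by (simp only: of_nat_le_iff)
  also have "\<dots> \<le> card R * (p * b * max (101 / 100 * card R) (3 / 100 * card V))"
    using XCle by (simp add: mult_left_mono)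
  finally have "real b * (2 * card (edges_between E R C))
      \<le> real b * (card R * p * max (101 / 100 * card R) (3 / 100 * card V))"
    by (simp add: algebra_simps)
  then have up: "2 * real (card (edges_between E R C))
      \<le> card R * p * max (101 / 100 * card R) (3 / 100 * card V)"
    using b by (simp add: mult_le_cancel_left_pos)
  have rp: "card R * p > 0" using r3 p_pos by simp
  have n: "real (card V) + 1 \<le> 2 * card (V - S)" "real (card V) \<ge> 1000"
    using U_large large by linarith+
  have rc: "real (card (V - S)) = real (card C) + real (card R)" using ur by simp
  show False
  proof (cases "card R < \<gamma> / 2 * card V")
    \<comment> \<open>\<open>R\<close> is too small for \<open>between_lower\<close>, so minimum
      degrees are used instead. \<open>V - C\<close> has at most \<open>2 * card R\<close> vertices
      and is sparse, so most edges at \<open>R\<close> lead to \<open>C\<close>; the constant arises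
      as \<open>38 / 100 = 2 * (1 / 4 - 2 * (3 / 100))\<close>.\<close>
    case True
    have VC: "V - C = R \<union> S" "R \<inter> S = {}" using CV S_subset by (auto simp: R_def)
    then have cVC: "card (V - C) = card R + card S"
      using finR finite_S by (simp add: card_Un_disjoint)
    have "card R * (card V * p / 4) = (\<Sum>v\<in>R. card V * p / 4)" by simp
    also have "\<dots> \<le> (\<Sum>v\<in>R. real (vertex_degree E v))"
      using min_degree RV by (intro sum_mono) auto
    finally have "card R * (card V * p / 4) \<le> (\<Sum>v\<in>R. real (vertex_degree E v))" .
    moreover have "(\<Sum>v\<in>R. vertex_degree E v) \<le> card (edges_between E R C) + 2 * card (edges_in E (V - C))"
      by (rule sum_degree_le[OF finite_E card_edge finite_V edge_subset])
        (use RV CV RC in auto)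
    then have "(\<Sum>v\<in>R. real (vertex_degree E v)) \<le> real (card (edges_between E R C)) + 2 * card (edges_in E (V - C))"
      by (metis of_nat_add of_nat_le_iff of_nat_mult of_nat_numeral of_nat_sum)
    moreover have "card (edges_in E (V - C)) \<le> (real (card (V - C)) - 1) / 2 * (3 / 100 * card V * p)"
    proof (rule small_sparse)
      show "2 \<le> card (V - C)" using cVC r3 by simp
      show "card (V - C) \<le> \<gamma> * card V" using cVC sr True by simp
    qed simp
    moreover have "(real (card (V - C)) - 1) / 2 * (3 / 100 * card V * p) \<le> real (card R) * (3 / 100 * card V * p)"
      using cVC sr p_pos by (intro mult_right_mono) auto
    ultimately have "card R * (card V * p / 4) \<le> card (edges_between E R C) + 2 * (real (card R) * (3 / 100 * card V * p))"
      by linarith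
    then have "card R * p * (38 / 100 * card V) \<le> 2 * real (card (edges_between E R C))"
      by (simp add: algebra_simps)
    then have "card R * p * (38 / 100 * card V) \<le> card R * p * max (101 / 100 * card R) (3 / 100 * card V)"
      using up by linarith
    then have "38 / 100 * card V \<le> max (101 / 100 * card R) (3 / 100 * real (card V))"
      using rp by (simp only: mult_le_cancel_left_pos)
    moreover have "\<gamma> / 2 * card V \<le> 1 / 200 * card V" using gamma by (intro mult_right_mono) auto
    ultimately show False using True n by linarith
  next
    case False
    have "\<gamma> / 2 * card V \<le> 1 / 200 * card V" using gamma by (intro mult_right_mono) auto
    then have "\<gamma> / 2 * card V \<le> card C" using C(2) n by linarith
    then have "99 / 100 * (p * (card R * card C)) \<le> card (edges_between E R C)"
      by (intro between_lower) (use False RV CV RC in auto)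
    then have "card R * p * (198 / 100 * card C) \<le> 2 * real (card (edges_between E R C))"
      by (simp add: algebra_simps)
    then have "card R * p * (198 / 100 * card C) \<le> card R * p * max (101 / 100 * card R) (3 / 100 * card V)"
      using up by linarith
    then have "198 / 100 * card C \<le> max (101 / 100 * card R) (3 / 100 * real (card V))"
      using rp by (simp only: mult_le_cancel_left_pos)
    \<comment> \<open>\<open>R\<close> has at most \<open>27 / 100\<close> of the vertices of
      \<open>V - S\<close>, and \<open>card V < 2 * card (V - S)\<close>, so both terms of the
      maximum are too small.\<close>
    then show False using C(2) rc n by linarith
  qed
qed

text \<open>With \<open>S\<close> nonempty, the competitor consists of all edges inside
  \<open>V - W2\<close>, where \<open>W2\<close> is a light set \<open>W\<close> of size
  \<open>card R\<close> without \<open>card S\<close> suitably chosen vertices. Using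
  \<open>W\<close> instead of \<open>R\<close> costs nothing: outside \<open>S\<close> it meets at
  most as many edges.\<close>

lemma S_empty:
  assumes C: "C \<in> P" "99 * (2 * real (card (V - S)) - (real k - card S) - 1) / 2 \<le> 101 * card C"
    and trivial: "(\<Sum>D\<in>P - {C}. card D div 2) = 0"
  shows "S = {}"
proof (rule ccontr)
  assume S: "S \<noteq> {}"
  have CV: "C \<subseteq> V - S" "finite C" using part_subset C finite_part by auto
  define R w where "R = V - S - C" and "w = card R"
  have finR: "finite R" using finite_V by (simp add: R_def)
  have UR: "\<Union>(P - {C}) = R"
    using Union_P C disjoint_P by (auto simp: R_def pairwise_def disjnt_def)
  have "w = card (P - {C})"
    using sum_card_parts[of "P - {C}"] UR trivial by (auto simp: w_def)
  moreover have "card (P - {C}) = card P - 1" using C by simp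
  ultimately have sw: "card S \<le> w" using card_S_lt by linarith
  have s0: "card S > 0" using S finite_S by (simp add: card_gt_0_iff)
  have k: "k = card S + card C div 2"
    using k_eq C finite_P trivial by (simp add: sum.remove)
  have ur: "card (V - S) = card C + w"
    using CV finite_V card_mono[OF _ CV(1)] by (simp add: R_def w_def card_Diff_subset)
  have n: "real (card V) + 1 \<le> 2 * card (V - S)" "real (card V) \<ge> 1000"
    using U_large large by linarith+
  \<comment> \<open>Now \<open>k - card S = card C div 2\<close>, so the hypothesis on
    \<open>C\<close> reads \<open>99 * card (V - S) <= 125.75 * card C\<close> up to an additive
    constant. Thus \<open>w\<close> is about \<open>0.213 * card (V - S)\<close> at most, and
    \<open>large\<close> absorbs the constant.\<close>
  have w_le: "w \<le> 215 / 1000 * card (V - S)"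
  proof -
    have "real (card C) = 2 * real (card C div 2) + 1"
      using card_part[OF C(1)] by (metis of_nat_1 of_nat_add of_nat_mult of_nat_numeral)
    moreover have "real k = card S + real (card C div 2)" using k by simp
    moreover have "real (card (V - S)) = real (card C) + w" using ur by simp
    ultimately show ?thesis using C(2) n by (simp add: field_simps)
  qed
  have un: "card (V - S) \<le> card V" using card_S_U by linarith
  have triv_part: "edges_in E D = {}" if "D \<in> P" "D \<noteq> C" for D
  proof -
    have "card D div 2 = 0" using trivial that finite_P by simp
    then show ?thesis using edges_in_small finite_part that by (metis card_part le_refl add_0 mult_0_right)
  qed
  have H: "H = {e \<in> E. e \<inter> S \<noteq> {} \<or> e \<subseteq> C}"
    unfolding H_eq using C triv_part by (auto simp: edges_in_def)
  let ?F = "\<lambda>W. edges_meeting (edges_in E (V - S)) W"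
  have EH: "card E = card H + card (?F R)"
  proof -
    have "E = H \<union> ?F R" "H \<inter> ?F R = {}"
      using edge_subset CV by (fastforce simp: H edges_meeting_def edges_in_def R_def)+
    then show ?thesis using finite_E by (metis card_Un_disjoint finite_Un)
  qed
  define W where "W = light_set E V S w"
  have W: "W \<subseteq> V - S" "card W = w" "card (?F W) \<le> card (?F R)"
    using light_set[of R V S w E] by (auto simp: W_def w_def R_def)
  have finW: "finite W" using W finite_V by (meson finite_Diff finite_subset)
  have WV: "W \<subseteq> V" using W by auto
  have VW: "card (V - W) = card V - w" using finW WV W by (simp add: card_Diff_subset)
  have SW: "card (edges_between E S W)
      < card S * (card V * p * (if w < \<gamma> / 2 * card V then 22 / 100 else 75 / 100))"
    unfolding W_def by (rule light_set_sparse[OF S_subset S]) (use ur w_le un in linarith)+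
  have WVW: "w * (card V * p * (if w < \<gamma> / 2 * card V then 22 / 100 else 75 / 100))
      \<le> card (edges_between E W (V - W))"
  proof (cases "w < \<gamma> / 2 * card V")
    case True
    have "w * (card V * p / 4) = (\<Sum>v\<in>W. card V * p / 4)" by (simp add: W(2))
    also have "\<dots> \<le> (\<Sum>v\<in>W. real (vertex_degree E v))"
      using min_degree WV by (intro sum_mono) auto
    finally have "w * (card V * p / 4) \<le> (\<Sum>v\<in>W. real (vertex_degree E v))" .
    moreover have "V - (V - W) = W" using WV by auto
    then have "(\<Sum>v\<in>W. vertex_degree E v) \<le> card (edges_between E W (V - W)) + 2 * card (edges_in E W)"
      using sum_degree_le[OF finite_E card_edge finite_V edge_subset WV, of "V - W"] by auto
    then have "(\<Sum>v\<in>W. real (vertex_degree E v)) \<le> real (card (edges_between E W (V - W))) + 2 * card (edges_in E W)"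
      by (metis of_nat_add of_nat_le_iff of_nat_mult of_nat_numeral of_nat_sum)
    moreover have "card (edges_in E W) \<le> real w / 2 * (3 / 100 * card V * p)"
    proof (cases "w \<ge> 2")
      case True
      then have "card (edges_in E W) \<le> (real (card W) - 1) / 2 * (3 / 100 * card V * p)"
        using \<open>w < \<gamma> / 2 * card V\<close> gamma W(2) by (intro small_sparse[OF WV]) auto
      also have "\<dots> \<le> real w / 2 * (3 / 100 * card V * p)"
        using W(2) p_pos by (intro mult_right_mono) auto
      finally show ?thesis .
    next
      case False
      then show ?thesis using edges_in_small[OF finW] W(2) p_pos by simp
    qed
    ultimately have "w * (card V * p / 4) \<le> card (edges_between E W (V - W)) + 2 * (real w / 2 * (3 / 100 * card V * p))"
      by linarith
    then show ?thesis using True by (simp add: algebra_simps)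
  next
    case False
    have g: "\<gamma> / 2 * card V \<le> 1 / 200 * card V" using gamma by (intro mult_right_mono) auto
    have rVW: "real (card (V - W)) \<ge> 785 / 1000 * card V"
      using VW w_le un ur by linarith
    have "99 / 100 * (p * (card W * card (V - W))) \<le> card (edges_between E W (V - W))"
      using False g rVW W(2) WV by (intro between_lower) auto
    moreover have "w * p * (75 / 100 * card V) \<le> w * p * (99 / 100 * card (V - W))"
      using rVW p_pos by (intro mult_left_mono) auto
    ultimately show ?thesis using False W(2) by (simp add: algebra_simps)
  qed
  have w0: "w > 0" using s0 sw by simp
  \<comment> \<open>\<open>SW\<close> and \<open>WVW\<close> bound the two averages by the same
    quantity, once strictly from above and once from below.\<close>
  have key: "w * card (edges_between E S W) < card S * card (edges_between E W (V - W))"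
  proof -
    let ?y = "card V * p * (if w < \<gamma> / 2 * card V then 22 / 100 else 75 / 100)"
    have "real w * card (edges_between E S W) < w * (card S * ?y)"
      using SW w0 by simp
    also have "\<dots> = card S * (w * ?y)" by simp
    also have "\<dots> \<le> card S * real (card (edges_between E W (V - W)))"
      using WVW by (intro mult_left_mono) auto
    finally show ?thesis by (simp flip: of_nat_mult)
  qed
  obtain W1 where W1: "W1 \<subseteq> W" "card W1 = card S"
    "card S * card (edges_between E W (V - W)) \<le> card W * card (edges_between E W1 (V - W))"
    using edges_between_subset_averaging[OF finite_E card_edge finW, of "V - W" "card S"] W(2) sw by auto
  have gain: "card (edges_between E S W) < card (edges_between E W1 (V - W))"
    using key W1(3) W(2) w0 by (metis le_less_trans less_le_trans mult_less_cancel1)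
  define W2 where "W2 = W - W1"
  have W12: "W1 \<inter> W2 = {}" "W = W1 \<union> W2" "W2 \<subseteq> V" using W1 WV by (auto simp: W2_def)
  have cW2: "card W2 = w - card S"
    using W1 W(2) finW by (simp add: W2_def card_Diff_subset finite_subset)
  \<comment> \<open>Half of this, rounded down, is \<open>card C div 2 + card S = k\<close>.\<close>
  have "card (V - W2) = card C + 2 * card S"
    using cW2 W12 card_S_U ur sw finite_V by (simp add: card_Diff_subset finite_subset)
  then have "card {e \<in> E. e \<inter> {} \<noteq> {} \<or> (\<exists>D\<in>{V - W2}. e \<subseteq> D)} \<le> card H"
    using k by (intro H_ge) auto
  then have "card (edges_in E (V - W2)) \<le> card H" by (simp add: edges_in_def)
  then have up: "card (?F R) \<le> card (edges_meeting E W2)"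
    using card_edges_meeting[of W2] EH by linarith
  have fin: "finite (edges_between E A B)" "finite (?F A)" for A B
    using finite_E by (auto simp: edges_meeting_def edges_in_def edges_between_def)
  have "edges_meeting E W2 \<subseteq> ?F W2 \<union> edges_between E S W2"
    using edge_subset by (auto simp: edges_meeting_def edges_in_def edges_between_def)
  then have 1: "card (edges_meeting E W2) \<le> card (?F W2) + card (edges_between E S W2)"
    using fin by (meson card_Un_le card_mono finite_UnI order_trans)
  have sub: "e \<subseteq> W1 \<union> (V - S - W)" if "e \<in> edges_between E W1 (V - S - W)" for e
    by (rule edges_between_subset_Un[OF that]) (use that card_edge W1 in \<open>auto simp: edges_between_def\<close>)
  have sub': "e \<in> ?F W" "e \<inter> W2 = {}" if e: "e \<in> edges_between E W1 (V - S - W)" for e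
  proof -
    have "e \<subseteq> V - S" "e \<inter> W2 = {}" using sub[OF e] W12(1,2) W(1) by blast+
    moreover have "e \<in> E" "e \<inter> W \<noteq> {}" using e W12(2) by (auto simp: edges_between_def)
    ultimately show "e \<in> ?F W" "e \<inter> W2 = {}" by (auto simp: edges_meeting_def edges_in_def)
  qed
  have "?F W2 \<subseteq> ?F W" using W12(2) by (auto simp: edges_meeting_def)
  then have "?F W2 \<union> edges_between E W1 (V - S - W) \<subseteq> ?F W" using sub'(1) by blast
  moreover have "?F W2 \<inter> edges_between E W1 (V - S - W) = {}"
    using sub'(2) unfolding edges_meeting_def by blast
  ultimately have 2: "card (?F W2) + card (edges_between E W1 (V - S - W)) \<le> card (?F W)"
    using fin by (metis card_Un_disjoint card_mono)
  have subS: "e \<subseteq> S \<union> W2" if "e \<in> edges_between E S W2" for e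
    by (rule edges_between_subset_Un[OF that]) (use that card_edge W(1) W12 in \<open>auto simp: edges_between_def\<close>)
  have "edges_between E S W2 \<union> edges_between E S W1 \<subseteq> edges_between E S W"
    using W12 by (auto simp: edges_between_def)
  moreover have "e \<inter> W1 = {}" if "e \<in> edges_between E S W2" for e
    using subS[OF that] W12(1,2) W(1) by blast
  then have "edges_between E S W2 \<inter> edges_between E S W1 = {}"
    unfolding edges_between_def by blast
  ultimately have 3: "card (edges_between E S W2) + card (edges_between E S W1) \<le> card (edges_between E S W)"
    using fin by (metis card_Un_disjoint card_mono)
  have "edges_between E W1 (V - W) \<subseteq> edges_between E W1 (V - S - W) \<union> edges_between E S W1"
    by (auto simp: edges_between_def)
  then have 4: "card (edges_between E W1 (V - W)) \<le> card (edges_between E W1 (V - S - W)) + card (edges_between E S W1)"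
    using fin by (meson card_Un_le card_mono finite_UnI order_trans)
  \<comment> \<open>By 1 to 4, at most \<open>card (?F W) + card (edges_between E S W) - card
    (edges_between E W1 (V - W))\<close> edges meet \<open>W2\<close>. By \<open>gain\<close> this
    is less than \<open>card (?F W)\<close>, hence less than \<open>card (?F R)\<close>,
    contradicting \<open>up\<close>.\<close>
  show False using up 1 2 3 4 gain W(3) by linarith
qed

lemma extremal_form:
  "(\<exists>A\<subseteq>V. card A = 2 * k + 1 \<and> H = {e \<in> E. e \<subseteq> A}) \<or>
   (\<exists>A\<subseteq>V. card A = k \<and> H = {e \<in> E. e \<inter> A \<noteq> {}})"
proof (cases "card S < k")
  case False
  then have sk: "card S = k" and sum0: "(\<Sum>C\<in>P. card C div 2) = 0" using k_eq by linarith+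
  have "edges_in E C = {}" if "C \<in> P" for C
    using sum0 that finite_P card_part[OF that] edges_in_small[OF finite_part[OF that]] by simp
  then have "H = {e \<in> E. e \<inter> S \<noteq> {}}" unfolding H_eq by (auto simp: edges_in_def)
  then show ?thesis using S_subset sk by blast
next
  case True
  obtain C where C: "C \<in> P" "73 / 100 * card (V - S) \<le> card C"
    "99 * (2 * real (card (V - S)) - (real k - card S) - 1) / 2 \<le> 101 * card C"
    using ex_giant_part[OF True] by metis
  have triv: "(\<Sum>D\<in>P - {C}. card D div 2) = 0" by (rule other_parts_trivial[OF C(1,2)])
  have S: "S = {}" by (rule S_empty[OF C(1,3) triv])
  have k: "k = card C div 2"
    using k_eq C finite_P triv S by (simp add: sum.remove)
  then have "card C = 2 * k + 1" using card_part[OF C(1)] by simp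
  moreover have "edges_in E D = {}" if "D \<in> P" "D \<noteq> C" for D
  proof -
    have "card D div 2 = 0" using triv that finite_P by simp
    then show ?thesis using card_part[OF that(1)] edges_in_small[OF finite_part[OF that(1)]] by simp
  qed
  then have "H = {e \<in> E. e \<subseteq> C}"
    unfolding H_eq using C(1) S by (auto simp: edges_in_def)
  moreover have "C \<subseteq> V" using part_subset[OF C(1)] by auto
  ultimately show ?thesis by blast
qed

end

theorem (in pseudorandom) has_EG_property: "EG_property V E"
  unfolding EG_property_def
proof (intro allI impI)
  fix k H
  assume k: "k \<le> matching_number E" and H: "largest_subgraph_with_matching_number E k H"
  have HE: "H \<subseteq> E" and Hk: "matching_number H = k"
    using H by (auto simp: largest_subgraph_with_matching_number_def)
  have n: "2 * matching_number E \<le> card V" by (rule two_matching_number_le[OF finite_V edges])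
  show "(\<exists>A\<subseteq>V. card A = min (2 * k + 1) (card V) \<and> H = {e \<in> E. e \<subseteq> A}) \<or>
        (\<exists>A\<subseteq>V. card A = k \<and> H = {e \<in> E. e \<inter> A \<noteq> {}})"
  proof (cases "2 * k + 1 \<le> card V")
    \<comment> \<open>This is the perfect matching case \<open>2 * k = card V\<close>, where the
      \<open>min\<close> in the definition of the property takes effect.\<close>
    case False
    then have "k = matching_number E" using k n by linarith
    then have "card E \<le> card H" using largest_subgraph_ge[OF finite_E H k, of E] by simp
    then have "H = E" using HE finite_E by (simp add: card_seteq)
    then have "H = {e \<in> E. e \<subseteq> V}" using edge_subset by auto
    then show ?thesis using False by (intro disjI1 exI[of _ V]) auto
  next
    case True
    interpret largest_subgraph V E p \<gamma> k H by unfold_locales (fact H k True)+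
    have "H \<subseteq> complete_edges V" using HE edges by blast
    then obtain S P where SP: "S \<subseteq> V" "\<Union>P = V - S" "pairwise disjnt P" "\<And>C. C \<in> P \<Longrightarrow> odd (card C)"
      "\<And>e. e \<in> H \<Longrightarrow> e \<inter> S \<noteq> {} \<or> (\<exists>C\<in>P. e \<subseteq> C)"
      "card S + (\<Sum>C\<in>P. card C div 2) \<le> matching_number H"
      using tutte_berge[OF finite_V] by metis
    have finP: "finite P" using SP(2) finite_V by (metis finite_Diff finite_UnionD)
    \<comment> \<open>Tutte--Berge only places \<open>H\<close> inside \<open>?H\<close>. Since
      \<open>?H\<close> has matching number at most \<open>k\<close>, maximality of \<open>H\<close>
      forces equality.\<close>
    let ?H = "{e \<in> E. e \<inter> S \<noteq> {} \<or> (\<exists>C\<in>P. e \<subseteq> C)}"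
    have sub: "H \<subseteq> ?H" using HE SP(5) by blast
    have "card ?H \<le> card H" using SP Hk finP by (intro H_ge) auto
    then have "H = ?H" using sub finite_E by (intro card_seteq) auto
    moreover have "matching_number H \<le> card S + (\<Sum>C\<in>P. card C div 2)"
    proof (rule matching_number_le_cover)
      show "finite S" using SP(1) finite_V finite_subset by blast
      show "finite C" if "C \<in> P" for C using that SP(2) finite_V
        by (metis Union_upper finite_Diff finite_subset)
      show "finite H" using HE finite_E finite_subset by blast
      show "card e = 2" if "e \<in> H" for e using that HE card_edge by blast
    qed (use SP(5) finP in auto)
    ultimately interpret largest_subgraph_partition V E p \<gamma> k H S P
      using SP Hk by unfold_locales auto
    show ?thesis using extremal_form True by (simp add: min_absorb1)
  qed
qed

section \<open>Random graphs are pseudorandom\<close>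

definition random_subset :: "'a set \<Rightarrow> real \<Rightarrow> 'a set pmf" where
  "random_subset A p = map_pmf (\<lambda>coin. {e \<in> A. coin e}) (Pi_pmf A False (\<lambda>_. bernoulli_pmf p))"

lemma random_graph_eq: "random_graph n p = random_subset (complete_edges {..<n}) p"
  by (simp add: random_graph_def random_subset_def)

lemma set_random_subset: "set_pmf (random_subset A p) \<subseteq> Pow A"
  by (auto simp: random_subset_def)

text \<open>The exponential Markov inequality behind Chernoff bounds. As \<open>\<theta>\<close> may
  have either sign and multiplies the count inside the event, one statement covers both
  tails.\<close>

lemma random_subset_tail:
  fixes p \<theta> x :: real
  assumes "finite A" "F \<subseteq> A" "0 \<le> p" "p \<le> 1"
  shows "measure_pmf.prob (random_subset A p) {X. x \<le> \<theta> * card (X \<inter> F)}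
    \<le> exp (p * card F * (exp \<theta> - 1) - x)"
proof -
  let ?M = "measure_pmf (Pi_pmf A False (\<lambda>_. bernoulli_pmf p))"
  define f where "f e c = (if e \<in> F \<and> c then exp \<theta> else 1)" for e and c :: bool
  have finF: "finite F" using assms finite_subset by blast
  have prod: "(\<Prod>e\<in>A. f e (coin e)) = exp (\<theta> * card ({e \<in> A. coin e} \<inter> F))" for coin
  proof -
    have "(\<Prod>e\<in>A. f e (coin e)) = exp \<theta> ^ card (A \<inter> {e. e \<in> F \<and> coin e})"
      using assms(1) by (simp add: f_def prod.If_cases)
    also have "A \<inter> {e. e \<in> F \<and> coin e} = {e \<in> A. coin e} \<inter> F" by auto
    finally show ?thesis by (simp add: exp_of_nat_mult[symmetric] mult.commute)
  qed
  have int: "integrable ?M (\<lambda>coin. \<Prod>e\<in>A. f e (coin e))"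
    by (intro integrable_prod_Pi_pmf assms integrable_measure_pmf_finite) simp
  have "measure_pmf.expectation (Pi_pmf A False (\<lambda>_. bernoulli_pmf p)) (\<lambda>coin. \<Prod>e\<in>A. f e (coin e))
      = (\<Prod>e\<in>A. measure_pmf.expectation (bernoulli_pmf p) (f e))"
    by (intro expectation_prod_Pi_pmf assms integrable_measure_pmf_finite) (auto simp: f_def)
  also have "\<dots> = (\<Prod>e\<in>A. if e \<in> F then 1 + p * (exp \<theta> - 1) else 1)"
    using assms by (intro prod.cong) (auto simp: f_def algebra_simps)
  also have "\<dots> = (1 + p * (exp \<theta> - 1)) ^ card F"
    using assms by (simp add: prod.If_cases Int_absorb1)
  \<comment> \<open>This is \<open>1 + y <= exp y\<close>. Raising it to a power needs a nonnegative
    base, which for negative \<open>\<theta>\<close> relies on \<open>p \<le> 1\<close>.\<close>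
  also have "\<dots> \<le> exp (p * (exp \<theta> - 1)) ^ card F"
  proof (rule power_mono)
    have "p * (1 - exp \<theta>) \<le> 1 * 1" if "exp \<theta> \<le> 1"
      using assms that by (intro mult_mono) auto
    moreover have "0 \<le> p * (exp \<theta> - 1)" if "exp \<theta> \<ge> 1" using assms that by simp
    ultimately show "0 \<le> 1 + p * (exp \<theta> - 1)" by (cases "exp \<theta> \<le> 1") (auto simp: algebra_simps)
  qed simp
  also have "\<dots> = exp (p * card F * (exp \<theta> - 1))"
    by (simp add: exp_of_nat_mult[symmetric] algebra_simps)
  finally have mgf: "measure_pmf.expectation (Pi_pmf A False (\<lambda>_. bernoulli_pmf p)) (\<lambda>coin. \<Prod>e\<in>A. f e (coin e))
      \<le> exp (p * card F * (exp \<theta> - 1))" .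
  have "measure_pmf.prob (random_subset A p) {X. x \<le> \<theta> * card (X \<inter> F)}
      = measure ?M {coin \<in> space ?M. exp x \<le> (\<Prod>e\<in>A. f e (coin e))}"
    by (simp add: random_subset_def prod)
  also have "\<dots> \<le> measure_pmf.expectation (Pi_pmf A False (\<lambda>_. bernoulli_pmf p)) (\<lambda>coin. \<Prod>e\<in>A. f e (coin e)) / exp x"
    by (rule integral_Markov_inequality_measure[OF int, of "{}"])
      (auto simp: f_def intro!: prod_nonneg)
  also have "\<dots> \<le> exp (p * card F * (exp \<theta> - 1)) / exp x"
    using mgf by (simp add: divide_right_mono)
  finally show ?thesis by (simp add: exp_diff)
qed

lemma random_subset_Un:
  assumes "finite A" "finite B" "A \<inter> B = {}"
  shows "random_subset (A \<union> B) p
    = bind_pmf (random_subset B p) (\<lambda>Y. map_pmf (\<lambda>X. X \<union> Y) (random_subset A p))"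
proof -
  have "random_subset (A \<union> B) p = map_pmf (\<lambda>(f, g). {e \<in> A. f e} \<union> {e \<in> B. g e})
      (pair_pmf (Pi_pmf A False (\<lambda>_. bernoulli_pmf p)) (Pi_pmf B False (\<lambda>_. bernoulli_pmf p)))"
    unfolding random_subset_def Pi_pmf_union[OF assms] pmf.map_comp
    by (intro map_pmf_cong refl) (use assms(3) in \<open>auto simp: fun_eq_iff\<close>)
  also have "\<dots> = bind_pmf (random_subset B p) (\<lambda>Y. map_pmf (\<lambda>X. X \<union> Y) (random_subset A p))"
    unfolding random_subset_def pair_pmf_def
    by (subst bind_commute_pmf) (simp add: map_pmf_def bind_assoc_pmf bind_return_pmf)
  finally show ?thesis .
qed

text \<open>Conditioning on the outcome \<open>Y\<close> in \<open>B\<close>: a bound valid for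
  every fixed \<open>Y\<close> holds for the whole. It is used with \<open>A\<close> the potential
  edges at \<open>S\<close> and \<open>B\<close> those outside \<open>S\<close>.\<close>

lemma prob_random_subset_Un_le:
  assumes "finite A" "finite B" "A \<inter> B = {}"
    and "\<And>Y. Y \<subseteq> B \<Longrightarrow> measure_pmf.prob (random_subset A p) {X. X \<subseteq> A \<and> X \<union> Y \<in> Q} \<le> b" "0 \<le> b"
  shows "measure_pmf.prob (random_subset (A \<union> B) p) Q \<le> b"
proof -
  have "emeasure (measure_pmf (map_pmf (\<lambda>X. X \<union> Y) (random_subset A p))) Q \<le> ennreal b" if "Y \<subseteq> B" for Y
  proof -
    have "emeasure (measure_pmf (map_pmf (\<lambda>X. X \<union> Y) (random_subset A p))) Q
        = ennreal (measure_pmf.prob (random_subset A p) ({X. X \<union> Y \<in> Q} \<inter> set_pmf (random_subset A p)))"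
      by (simp add: measure_pmf.emeasure_eq_measure vimage_def measure_Int_set_pmf)
    also have "\<dots> \<le> ennreal (measure_pmf.prob (random_subset A p) {X. X \<subseteq> A \<and> X \<union> Y \<in> Q})"
      using set_random_subset[of A p]
      by (intro ennreal_leI measure_pmf.finite_measure_mono) auto
    also have "\<dots> \<le> ennreal b" using assms(4)[OF that] by (rule ennreal_leI)
    finally show ?thesis .
  qed
  then have "emeasure (measure_pmf (random_subset (A \<union> B) p)) Q \<le> (\<integral>\<^sup>+ Y. ennreal b \<partial>measure_pmf (random_subset B p))"
    unfolding random_subset_Un[OF assms(1-3)] emeasure_bind_pmf
    using set_random_subset[of B p] by (intro nn_integral_mono_AE) (auto simp: AE_measure_pmf_iff)
  then show ?thesis
    using assms(5) by (simp add: measure_pmf.emeasure_eq_measure)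
qed

lemma prob_ex_le:
  assumes "finite I"
  shows "measure_pmf.prob M {x. \<exists>i\<in>I. Q i x} \<le> (\<Sum>i\<in>I. measure_pmf.prob M {x. Q i x})"
proof -
  have "{x. \<exists>i\<in>I. Q i x} = (\<Union>i\<in>I. {x. Q i x})" by auto
  then show ?thesis using measure_UNION_le[of I "\<lambda>i. {x. Q i x}" "measure_pmf M"] assms by auto
qed

text \<open>This evaluates the union bounds over all nonempty vertex sets; for \<open>x\<close> of
  smaller order than \<open>1 / card V\<close> the value is small.\<close>

lemma sum_nonempty_subsets_power:
  assumes "finite V"
  shows "(\<Sum>S\<in>Pow V - {{}}. x ^ card S) = (1 + x :: real) ^ card V - 1"
proof -
  have "(1 + x) ^ card V = (\<Prod>v\<in>V. x + 1)" by (simp add: add.commute)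
  also have "\<dots> = (\<Sum>S\<in>Pow V. x ^ card S)"
    unfolding prod_add[OF assms] by (rule sum.cong) auto
  also have "\<dots> = 1 + (\<Sum>S\<in>Pow V - {{}}. x ^ card S)"
    using assms by (subst sum.remove[of _ "{}"]) auto
  finally show ?thesis by simp
qed

lemma card_edges_in_complete:
  assumes "finite V" "C \<subseteq> V"
  shows "real (card (edges_in (complete_edges V) C)) = card C * (real (card C) - 1) / 2"
proof -
  have "edges_in (complete_edges V) C = {e. e \<subseteq> C \<and> card e = 2}"
    using assms by (auto simp: edges_in_def complete_edges_def)
  moreover have "finite C" using assms finite_subset by blast
  ultimately have "card (edges_in (complete_edges V) C) = card C choose 2" by (simp add: n_subsets)
  also have "real (card C choose 2) = card C * (real (card C) - 1) / 2"
    by (cases "card C") (auto simp: choose_two real_of_nat_div algebra_simps)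
  finally show ?thesis .
qed

lemma card_edges_between_complete:
  assumes "finite V" "A \<subseteq> V" "B \<subseteq> V" "A \<inter> B = {}"
  shows "card (edges_between (complete_edges V) A B) = card A * card B"
proof -
  have "bij_betw (\<lambda>(a, b). {a, b}) (A \<times> B) (edges_between (complete_edges V) A B)"
  proof (rule bij_betwI')
    fix x y assume "x \<in> A \<times> B" "y \<in> A \<times> B"
    then show "((case x of (a, b) \<Rightarrow> {a, b}) = (case y of (a, b) \<Rightarrow> {a, b})) = (x = y)"
      using assms(4) by (auto simp: doubleton_eq_iff)
  next
    fix x assume "x \<in> A \<times> B"
    then obtain a b where x: "x = (a, b)" "a \<in> A" "b \<in> B" by auto
    then have "a \<noteq> b" using assms(4) by auto
    then show "(case x of (a, b) \<Rightarrow> {a, b}) \<in> edges_between (complete_edges V) A B"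
      using x assms by (auto simp: edges_between_def complete_edges_def)
  next
    fix e assume "e \<in> edges_between (complete_edges V) A B"
    then have e: "card e = 2" "e \<inter> A \<noteq> {}" "e \<inter> B \<noteq> {}"
      by (auto simp: edges_between_def complete_edges_def)
    then obtain a b where ab: "a \<in> e" "a \<in> A" "b \<in> e" "b \<in> B" by blast
    then have "a \<noteq> b" using assms(4) by auto
    then have "e = {a, b}" using e(1) ab by (auto simp: card_2_iff)
    then show "\<exists>x\<in>A \<times> B. e = (case x of (a, b) \<Rightarrow> {a, b})" using ab by auto
  qed
  then have "card (A \<times> B) = card (edges_between (complete_edges V) A B)" by (rule bij_betw_same_card)
  then show ?thesis by (simp add: card_cartesian_product)
qed

lemma edges_in_eq: "E \<subseteq> K \<Longrightarrow> edges_in E C = E \<inter> edges_in K C"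
  and edges_between_eq: "E \<subseteq> K \<Longrightarrow> edges_between E A B = E \<inter> edges_between K A B"
  by (auto simp: edges_in_def edges_between_def)

section \<open>Failure probabilities of the pseudorandomness conditions\<close>

context
  fixes n :: nat and p :: real
  assumes n: "n \<ge> 2" and p: "0 \<le> p" "p \<le> 1" "8 * ln (real n) \<le> n * p"
begin

lemma finite_K: "finite (complete_edges {..<n})"
  by (rule finite_complete_edges) simp

text \<open>Chernoff parameters \<open>-1 / 200\<close> and \<open>1 / 200\<close>: the quadratic
  error \<open>(1 / 200)^2 = 1 / 40000\<close> is half of the gain
  \<open>1 / 200 * (1 / 100)\<close> from the allowed deviation, so \<open>1 / 40000\<close> remains
  in the exponent.\<close>

lemma prob_concentration_fails:
  assumes "finite \<F>" "\<And>F. F \<in> \<F> \<Longrightarrow> F \<subseteq> complete_edges {..<n}" "\<And>F. F \<in> \<F> \<Longrightarrow> m \<le> real (card F)"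
  shows "measure_pmf.prob (random_graph n p) {E. \<exists>F\<in>\<F>. \<not> (99 / 100 * (p * card F) \<le> card (E \<inter> F)
      \<and> card (E \<inter> F) \<le> 101 / 100 * (p * card F))} \<le> card \<F> * (2 * exp (- (p * m / 40000)))"
proof -
  have "measure_pmf.prob (random_graph n p) {E. \<not> (99 / 100 * (p * card F) \<le> card (E \<inter> F)
      \<and> card (E \<inter> F) \<le> 101 / 100 * (p * card F))} \<le> 2 * exp (- (p * m / 40000))" if F: "F \<in> \<F>" for F
  proof -
    let ?P = "measure_pmf.prob (random_graph n p)"
    have "{E. \<not> (99 / 100 * (p * card F) \<le> card (E \<inter> F) \<and> card (E \<inter> F) \<le> 101 / 100 * (p * card F))}
      \<subseteq> {E. - 1 / 200 * (99 / 100 * (p * card F)) \<le> - 1 / 200 * real (card (E \<inter> F))}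
        \<union> {E. 1 / 200 * (101 / 100 * (p * card F)) \<le> 1 / 200 * real (card (E \<inter> F))}"
      by auto
    then have "?P {E. \<not> (99 / 100 * (p * card F) \<le> card (E \<inter> F) \<and> card (E \<inter> F) \<le> 101 / 100 * (p * card F))}
      \<le> ?P ({E. - 1 / 200 * (99 / 100 * (p * card F)) \<le> - 1 / 200 * real (card (E \<inter> F))}
        \<union> {E. 1 / 200 * (101 / 100 * (p * card F)) \<le> 1 / 200 * real (card (E \<inter> F))})"
      by (intro measure_pmf.finite_measure_mono) auto
    also have "\<dots> \<le> ?P {E. - 1 / 200 * (99 / 100 * (p * card F)) \<le> - 1 / 200 * real (card (E \<inter> F))}
        + ?P {E. 1 / 200 * (101 / 100 * (p * card F)) \<le> 1 / 200 * real (card (E \<inter> F))}"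
      by (rule measure_Un_le) auto
    also have "?P {E. - 1 / 200 * (99 / 100 * (p * card F)) \<le> - 1 / 200 * real (card (E \<inter> F))}
      \<le> exp (p * card F * (exp (- 1 / 200) - 1) - (- 1 / 200 * (99 / 100 * (p * card F))))"
      unfolding random_graph_eq by (rule random_subset_tail[OF finite_K assms(2)[OF F] p(1,2)])
    also have "\<dots> \<le> exp (- (p * card F / 40000))"
    proof -
      have "exp (- 1 / 200) \<le> 1 / (1 + 1 / 200 :: real)"
        using exp_ge_add_one_self[of "1 / 200 :: real"] by (simp add: exp_minus field_simps)
      also have "\<dots> \<le> 1 - 1 / 200 + 1 / 40000" by simp
      finally have "p * card F * (exp (- 1 / 200) - 1) \<le> p * card F * (- 1 / 200 + 1 / 40000)"
        using p by (intro mult_left_mono) auto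
      then show ?thesis by (simp add: field_simps)
    qed
    also have "?P {E. 1 / 200 * (101 / 100 * (p * card F)) \<le> 1 / 200 * real (card (E \<inter> F))}
      \<le> exp (p * card F * (exp (1 / 200) - 1) - 1 / 200 * (101 / 100 * (p * card F)))"
      unfolding random_graph_eq by (rule random_subset_tail[OF finite_K assms(2)[OF F] p(1,2)])
    also have "\<dots> \<le> exp (- (p * card F / 40000))"
    proof -
      have "exp (1 / 200) \<le> 1 + 1 / 200 + (1 / 200 :: real)\<^sup>2" by (rule exp_bound) auto
      then have "p * card F * (exp (1 / 200) - 1) \<le> p * card F * (1 / 200 + 1 / 40000)"
        using p by (intro mult_left_mono) (auto simp: power2_eq_square)
      then show ?thesis by (simp add: field_simps)
    qed
    also have "exp (- (p * card F / 40000)) + exp (- (p * card F / 40000)) \<le> 2 * exp (- (p * m / 40000))"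
      using assms(3)[OF F] p by (simp add: mult_left_mono)
    finally show ?thesis by simp
  qed
  then have "(\<Sum>F\<in>\<F>. measure_pmf.prob (random_graph n p) {E. \<not> (99 / 100 * (p * card F) \<le> card (E \<inter> F)
      \<and> card (E \<inter> F) \<le> 101 / 100 * (p * card F))}) \<le> card \<F> * (2 * exp (- (p * m / 40000)))"
    by (rule sum_bounded_above)
  then show ?thesis
    using prob_ex_le[OF assms(1)] by (rule order_trans[rotated])
qed

text \<open>
  The Chernoff parameter is \<open>100\<close>, and sizes up to \<open>exp (-100) * n\<close> are small enough to cancel the
  resulting factor \<open>exp 100\<close>.
\<close>

lemma prob_small_sparse_fails:
  "measure_pmf.prob (random_graph n p) {E. \<exists>C\<in>Pow {..<n} - {{}}. 2 \<le> card C \<and> card C \<le> exp (-100) * n \<and>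
      (real (card C) - 1) / 2 * (3 / 100 * n * p) < card (E \<inter> edges_in (complete_edges {..<n}) C)}
    \<le> (1 + 1 / (real n)\<^sup>2) ^ n - 1"
proof -
  let ?P = "measure_pmf.prob (random_graph n p)" and ?K = "complete_edges {..<n}"
  have "?P {E. 2 \<le> card C \<and> card C \<le> exp (-100) * n \<and>
      (real (card C) - 1) / 2 * (3 / 100 * n * p) < card (E \<inter> edges_in ?K C)} \<le> (1 / (real n)\<^sup>2) ^ card C"
    if C: "C \<in> Pow {..<n} - {{}}" for C
  proof (cases "2 \<le> card C \<and> card C \<le> exp (-100) * n")
    case False
    then have *: "{E. 2 \<le> card C \<and> card C \<le> exp (-100) * n \<and>
      (real (card C) - 1) / 2 * (3 / 100 * n * p) < card (E \<inter> edges_in ?K C)} = {}" by auto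
    show ?thesis unfolding * by simp
  next
    case True
    let ?c = "real (card C)"
    have c: "?c \<ge> 2" "?c \<le> exp (-100) * n" using True by auto
    have "?P {E. 2 \<le> card C \<and> card C \<le> exp (-100) * n \<and>
        (?c - 1) / 2 * (3 / 100 * n * p) < card (E \<inter> edges_in ?K C)}
      \<le> ?P {E. 100 * ((?c - 1) / 2 * (3 / 100 * n * p)) \<le> 100 * real (card (E \<inter> edges_in ?K C))}"
      by (intro measure_pmf.finite_measure_mono subsetI CollectI; (elim CollectE conjE)?; simp only: sets_measure_pmf UNIV_I | linarith)
    also have "\<dots> \<le> exp (p * card (edges_in ?K C) * (exp 100 - 1) - 100 * ((?c - 1) / 2 * (3 / 100 * n * p)))"
      unfolding random_graph_eq
      by (rule random_subset_tail[OF finite_K _ p(1,2)]) (auto simp: edges_in_def)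
    also have "\<dots> \<le> exp (- (2 * ?c * ln (real n)))"
    proof -
      have cK: "card (edges_in ?K C) = ?c * (?c - 1) / 2"
        using C by (intro card_edges_in_complete) auto
      have "p * card (edges_in ?K C) * (exp 100 - 1) \<le> p * ((exp (-100) * n) * (?c - 1) / 2) * exp 100"
        unfolding cK using c p
        by (intro mult_mono mult_left_mono divide_right_mono mult_right_mono) auto
      also have "\<dots> = (n * p) * ((?c - 1) / 2) * (exp (-100) * exp 100)" by simp
      also have "exp (-100) * exp (100::real) = 1" by (simp add: exp_minus)
      finally have "p * card (edges_in ?K C) * (exp 100 - 1) \<le> n * p * ((?c - 1) / 2)" by simp
      moreover have "100 * ((?c - 1) / 2 * (3 / 100 * n * p)) = 3 * (n * p * ((?c - 1) / 2))" by simp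
      moreover have "n * p * (?c - 1) = 2 * (n * p * ((?c - 1) / 2))" by simp
      ultimately have "p * card (edges_in ?K C) * (exp 100 - 1) - 100 * ((?c - 1) / 2 * (3 / 100 * n * p))
          \<le> - (n * p * (?c - 1))" by linarith
      \<comment> \<open>For \<open>?c\<close> at least 2, \<open>?c - 1\<close> is at least
        \<open>?c / 2\<close>.\<close>
      also have "\<dots> \<le> - (8 * ln (real n) * (?c / 2))"
        using mult_mono[OF p(3), of "?c / 2" "?c - 1"] c p n by auto
      also have "\<dots> \<le> - (2 * ?c * ln (real n))" using n c by (simp add: mult_left_mono)
      finally show ?thesis by simp
    qed
    also have "\<dots> = (1 / (real n)\<^sup>2) ^ card C"
    proof -
      have "exp (- (2 * ln (real n))) = 1 / (real n)\<^sup>2"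
        using n by (simp add: exp_minus inverse_eq_divide exp_double)
      moreover have "- (2 * ?c * ln (real n)) = ?c * (- (2 * ln (real n)))" by simp
      ultimately show ?thesis by (simp only: exp_of_nat_mult)
    qed
    finally show ?thesis .
  qed
  then have "(\<Sum>C\<in>Pow {..<n} - {{}}. ?P {E. 2 \<le> card C \<and> card C \<le> exp (-100) * n \<and>
      (real (card C) - 1) / 2 * (3 / 100 * n * p) < card (E \<inter> edges_in ?K C)})
    \<le> (\<Sum>C\<in>Pow {..<n} - {{}}. (1 / (real n)\<^sup>2) ^ card C)" by (rule sum_mono)
  also have "\<dots> = (1 + 1 / (real n)\<^sup>2) ^ n - 1"
    using sum_nonempty_subsets_power[of "{..<n}"] by simp
  finally have *: "(\<Sum>C\<in>Pow {..<n} - {{}}. ?P {E. 2 \<le> card C \<and> card C \<le> exp (-100) * n \<and>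
      (real (card C) - 1) / 2 * (3 / 100 * n * p) < card (E \<inter> edges_in ?K C)})
    \<le> (1 + 1 / (real n)\<^sup>2) ^ n - 1" .
  show ?thesis by (rule order_trans[OF prob_ex_le *]) simp
qed

text \<open>With Chernoff parameter \<open>-1\<close> and \<open>exp (-1) <= 1 / 2\<close>, the
  exponent is about \<open>- n * p / 4\<close>. The constant 8 in the bound on \<open>p\<close>
  makes this \<open>- 2 * ln n\<close>, which survives the sum over \<open>n\<close>
  vertices.\<close>

lemma prob_min_degree_fails:
  "measure_pmf.prob (random_graph n p) {E. \<exists>v\<in>{..<n}.
      card (E \<inter> edges_between (complete_edges {..<n}) {v} ({..<n} - {v})) < n * p / 4} \<le> 2 / n"
proof -
  let ?P = "measure_pmf.prob (random_graph n p)"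
  let ?F = "\<lambda>v. edges_between (complete_edges {..<n}) {v} ({..<n} - {v})"
  have "?P {E. card (E \<inter> ?F v) < n * p / 4} \<le> 2 / n * (1 / n)" if v: "v \<in> {..<n}" for v
  proof -
    have "card (?F v) = card {v} * card ({..<n} - {v})"
      using v by (intro card_edges_between_complete) auto
    then have cF: "real (card (?F v)) = real n - 1" using v by (simp add: of_nat_diff)
    have "?P {E. card (E \<inter> ?F v) < n * p / 4} \<le> ?P {E. (-1) * (n * p / 4) \<le> (-1) * real (card (E \<inter> ?F v))}"
      by (intro measure_pmf.finite_measure_mono) auto
    also have "\<dots> \<le> exp (p * card (?F v) * (exp (-1) - 1) - (-1) * (n * p / 4))"
      unfolding random_graph_eq
      by (rule random_subset_tail[OF finite_K _ p(1,2)]) (auto simp: edges_between_def)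
    also have "\<dots> \<le> exp (1 / 2 - 2 * ln (real n))"
    proof -
      have "exp (-1) \<le> (1 / 2 :: real)"
        using exp_ge_add_one_self[of "1 :: real"] by (simp add: exp_minus field_simps)
      then have "p * (real n - 1) * (exp (-1) - 1) \<le> p * (real n - 1) * (- 1 / 2)"
        using p n by (intro mult_left_mono) auto
      then have "p * card (?F v) * (exp (-1) - 1) - (-1) * (n * p / 4) \<le> p / 2 - n * p / 4"
        unfolding cF by (simp add: field_simps)
      also have "\<dots> \<le> 1 / 2 - 2 * ln (real n)" using p by simp
      finally show ?thesis by simp
    qed
    also have "\<dots> = exp (1 / 2) / (real n)\<^sup>2"
      using n by (simp add: exp_diff exp_double)
    also have "\<dots> \<le> 2 / (real n)\<^sup>2"
    proof -
      have "exp (1 / 2) \<le> 1 + 1 / 2 + (1 / 2 :: real)\<^sup>2" by (rule exp_bound) auto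
      also have "\<dots> \<le> 2" by (simp add: power2_eq_square)
      finally show ?thesis by (simp add: divide_right_mono)
    qed
    finally show ?thesis by (simp add: power2_eq_square)
  qed
  then have "(\<Sum>v\<in>{..<n}. ?P {E. card (E \<inter> ?F v) < n * p / 4}) \<le> (\<Sum>v\<in>{..<n}. 2 / n * (1 / n))"
    by (rule sum_mono)
  also have "\<dots> = 2 / n" using n by simp
  finally have *: "(\<Sum>v\<in>{..<n}. ?P {E. card (E \<inter> ?F v) < n * p / 4}) \<le> 2 / n" .
  show ?thesis by (rule order_trans[OF prob_ex_le *]) simp
qed

text \<open>Given the edges outside \<open>S\<close>, the light set is a fixed set \<open>W\<close>,
  while the \<open>card S * w\<close> potential edges between \<open>S\<close> and \<open>W\<close>
  are still independent coins. The exponent is \<open>12 / 5 = 8 * (3 / 10)\<close>; exceeding 2, it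
  beats the sums over \<open>w\<close> and over the vertex sets \<open>S\<close>.\<close>

lemma prob_light_set_dense:
  fixes \<omega> \<theta> y :: real
  assumes S: "S \<subseteq> {..<n}" and w: "w \<le> card ({..<n} - S)" "w \<le> \<omega> * n"
    and \<theta>: "\<theta> \<ge> 0" "\<omega> * (exp \<theta> - 1) - \<theta> * y \<le> - 3 / 10"
  shows "measure_pmf.prob (random_graph n p)
      {E. card S * (n * p * y) \<le> card (edges_between E S (light_set E {..<n} S w))}
    \<le> (n powr (- 12 / 5)) ^ card S"
proof -
  let ?K = "complete_edges {..<n}" and ?V = "{..<n}"
  define Q where "Q = {E. card S * (n * p * y) \<le> card (edges_between E S (light_set E ?V S w))}"
  let ?A = "edges_meeting ?K S" and ?B = "edges_in ?K (?V - S)"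
  have K: "?K = ?A \<union> ?B"
    by (auto simp: edges_meeting_def edges_in_def complete_edges_def)
  have fin: "finite ?A" "finite ?B" using finite_K by (auto simp: edges_meeting_def edges_in_def)
  have AB: "?A \<inter> ?B = {}" by (auto simp: edges_meeting_def edges_in_def)
  have "measure_pmf.prob (random_subset (?A \<union> ?B) p) Q \<le> (n powr (- 12 / 5)) ^ card S"
  proof (rule prob_random_subset_Un_le[OF fin AB])
    fix Y assume Y: "Y \<subseteq> ?B"
    define W where "W = light_set Y ?V S w"
    obtain W0 where "W0 \<subseteq> ?V - S" "card W0 = w"
      using w(1) by (meson obtain_subset_with_card_n)
    then have W: "W \<subseteq> ?V - S" "card W = w" using light_set[of W0 ?V S w Y] by (auto simp: W_def)
    let ?F = "edges_between ?K S W"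
    have cF: "card ?F = card S * w"
      using S W by (subst card_edges_between_complete) auto
    have *: "edges_between (X \<union> Y) S (light_set (X \<union> Y) ?V S w) = X \<inter> ?F" if X: "X \<subseteq> ?A" for X
    proof -
      \<comment> \<open>The edges of \<open>X\<close> meet \<open>S\<close>, so they do not
        influence the choice of the light set.\<close>
      have "edges_in (X \<union> Y) (?V - S) = edges_in Y (?V - S)"
        using X by (auto simp: edges_in_def edges_meeting_def)
      then have "light_set (X \<union> Y) ?V S w = W" by (simp add: light_set_def W_def)
      moreover have "edges_between (X \<union> Y) S W = X \<inter> ?F"
        using X Y by (auto simp: edges_between_def edges_meeting_def edges_in_def)
      ultimately show ?thesis by simp
    qed
    have "measure_pmf.prob (random_subset ?A p) {X. X \<subseteq> ?A \<and> X \<union> Y \<in> Q}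
        \<le> measure_pmf.prob (random_subset ?A p) {X. \<theta> * (card S * (n * p * y)) \<le> \<theta> * card (X \<inter> ?F)}"
      using \<theta>(1) by (intro measure_pmf.finite_measure_mono) (auto simp: Q_def * intro!: mult_left_mono)
    also have "\<dots> \<le> exp (p * card ?F * (exp \<theta> - 1) - \<theta> * (card S * (n * p * y)))"
      by (rule random_subset_tail[OF fin(1) _ p(1,2)]) (auto simp: edges_between_def edges_meeting_def)
    also have "\<dots> \<le> exp (card S * (- 12 / 5 * ln n))"
    proof -
      have "p * card ?F * (exp \<theta> - 1) = card S * p * (w * (exp \<theta> - 1))" by (simp add: cF)
      also have "\<dots> \<le> card S * p * (\<omega> * n * (exp \<theta> - 1))"
        using w(2) \<theta>(1) p by (intro mult_left_mono mult_right_mono) auto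
      finally have "p * card ?F * (exp \<theta> - 1) - \<theta> * (card S * (n * p * y))
          \<le> card S * p * n * (\<omega> * (exp \<theta> - 1) - \<theta> * y)"
        by (simp add: algebra_simps)
      also have "\<dots> \<le> card S * p * n * (- 3 / 10)"
        using \<theta>(2) p by (intro mult_left_mono) auto
      also have "\<dots> = card S * (- 3 / 10 * (n * p))" by simp
      also have "\<dots> \<le> card S * (- 12 / 5 * ln n)"
        by (rule mult_left_mono) (use p(3) in \<open>linarith, simp\<close>)
      finally show ?thesis by simp
    qed
    also have "\<dots> = (n powr (- 12 / 5)) ^ card S"
      using n by (simp only: exp_of_nat_mult) (simp add: powr_def)
    finally show "measure_pmf.prob (random_subset ?A p) {X. X \<subseteq> ?A \<and> X \<union> Y \<in> Q}
      \<le> (n powr (- 12 / 5)) ^ card S" .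
  qed simp
  then show ?thesis unfolding random_graph_eq Q_def using K by simp
qed

lemma prob_light_set_sparse_fails:
  "measure_pmf.prob (random_graph n p) {E. \<exists>S\<in>Pow {..<n} - {{}}. \<exists>w\<in>{..n}.
      w \<le> card ({..<n} - S) \<and> w \<le> 22 / 100 * real n \<and>
      card S * (n * p * (if w < exp (-100) / 2 * n then 22 / 100 else 75 / 100))
        \<le> card (edges_between E S (light_set E {..<n} S w))}
    \<le> (real n + 1) * ((1 + n powr (- 12 / 5)) ^ n - 1)"
proof -
  let ?P = "measure_pmf.prob (random_graph n p)"
  define Q where "Q S w E \<longleftrightarrow> w \<le> card ({..<n} - S) \<and> w \<le> 22 / 100 * real n \<and>
      card S * (n * p * (if w < exp (-100) / 2 * n then 22 / 100 else 75 / 100))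
        \<le> card (edges_between E S (light_set E {..<n} S w))" for S w E
  have each: "?P {E. Q S w E} \<le> (n powr (- 12 / 5)) ^ card S" if S: "S \<in> Pow {..<n} - {{}}" for S w
  proof (cases "w \<le> card ({..<n} - S) \<and> w \<le> 22 / 100 * real n")
    case False
    then have "{E. Q S w E} = {}" by (auto simp: Q_def)
    then show ?thesis by simp
  next
    case w: True
    have e1: "exp 1 \<le> (3 :: real)" by (rule exp_le)
    show ?thesis
    proof (cases "w < exp (-100) / 2 * n")
      case True
      have "exp (-100) \<le> (1 / 101 :: real)"
        using exp_ge_add_one_self[of "100 :: real"] by (simp add: exp_minus field_simps)
      then have "exp (-100) / 2 * n \<le> 1 / 200 * real n"
        by (intro mult_right_mono) auto
      then have w': "w \<le> 1 / 200 * real n" using True by linarith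
      have "exp 2 = exp 1 * exp (1 :: real)" by (simp flip: exp_add)
      also have "\<dots> \<le> 3 * 3" using e1 by (intro mult_mono) auto
      \<comment> \<open>Parameter 2 suits small \<open>w\<close>: with \<open>exp 2 <= 9\<close> the
        left side is at most \<open>0.04 - 0.44\<close>. For larger \<open>w\<close> parameter 1 and
        \<open>exp 1 <= 3\<close> give \<open>0.44 - 0.75\<close>, just below
        \<open>- 3 / 10\<close>.\<close>
      finally have "1 / 200 * (exp 2 - 1) - 2 * (22 / 100) \<le> (- 3 / 10 :: real)" by (simp add: field_simps)
      then show ?thesis
        using prob_light_set_dense[of S w "1 / 200" 2 "22 / 100"] S w w' True by (simp add: Q_def)
    next
      case False
      have "22 / 100 * (exp 1 - 1) - 1 * (75 / 100) \<le> (- 3 / 10 :: real)" using e1 by (simp add: field_simps)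
      then show ?thesis
        using prob_light_set_dense[of S w "22 / 100" 1 "75 / 100"] S w False by (simp add: Q_def)
    qed
  qed
  have "?P {E. \<exists>w\<in>{..n}. Q S w E} \<le> (real n + 1) * (n powr (- 12 / 5)) ^ card S"
    if S: "S \<in> Pow {..<n} - {{}}" for S
  proof -
    have "?P {E. \<exists>w\<in>{..n}. Q S w E} \<le> (\<Sum>w\<in>{..n}. ?P {E. Q S w E})" by (rule prob_ex_le) simp
    also have "\<dots> \<le> card {..n} * (n powr (- 12 / 5)) ^ card S"
      by (rule sum_bounded_above) (rule each[OF S])
    finally show ?thesis by (simp add: add.commute)
  qed
  then have "(\<Sum>S\<in>Pow {..<n} - {{}}. ?P {E. \<exists>w\<in>{..n}. Q S w E})
      \<le> (\<Sum>S\<in>Pow {..<n} - {{}}. (real n + 1) * (n powr (- 12 / 5)) ^ card S)" by (rule sum_mono)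
  also have "\<dots> = (real n + 1) * ((1 + n powr (- 12 / 5)) ^ n - 1)"
    using sum_nonempty_subsets_power[of "{..<n}"] by (simp flip: sum_distrib_left)
  finally have "?P {E. \<exists>S\<in>Pow {..<n} - {{}}. \<exists>w\<in>{..n}. Q S w E}
      \<le> (real n + 1) * ((1 + n powr (- 12 / 5)) ^ n - 1)"
    using prob_ex_le[of "Pow {..<n} - {{}}" "random_graph n p" "\<lambda>S E. \<exists>w\<in>{..n}. Q S w E"] by simp
  then show ?thesis unfolding Q_def .
qed

text \<open>Both kinds of potential edge sets that need concentration are collected for a single
  union bound. There are exponentially many, but each has quadratic size, so the failure exponent of
  order \<open>n * ln n\<close> wins.\<close>

definition uniform_sets :: "nat set set set" where
  "uniform_sets = edges_in (complete_edges {..<n}) ` {U. U \<subseteq> {..<n} \<and> exp (-100) * n \<le> card U} \<union>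
    (\<lambda>(A, B). edges_between (complete_edges {..<n}) A B) ` {(A, B). A \<subseteq> {..<n} \<and> B \<subseteq> {..<n} \<and>
      A \<inter> B = {} \<and> exp (-100) / 2 * n \<le> card A \<and> exp (-100) / 2 * n \<le> card B}"

lemma finite_uniform_sets: "finite uniform_sets"
  and card_uniform_sets: "card uniform_sets \<le> 2 * 4 ^ n"
proof -
  let ?I = "{U. U \<subseteq> {..<n} \<and> exp (-100) * n \<le> card U}"
  let ?J = "{(A, B). A \<subseteq> {..<n} \<and> B \<subseteq> {..<n} \<and>
      A \<inter> B = {} \<and> exp (-100) / 2 * n \<le> card A \<and> exp (-100) / 2 * n \<le> card B}"
  have I: "?I \<subseteq> Pow {..<n}" and J: "?J \<subseteq> Pow {..<n} \<times> Pow {..<n}" by auto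
  have fin: "finite ?I" "finite ?J"
    using finite_subset[OF I] finite_subset[OF J] by auto
  then show "finite uniform_sets" by (simp add: uniform_sets_def)
  have "card uniform_sets \<le> card ?I + card ?J"
    unfolding uniform_sets_def
    by (intro order_trans[OF card_Un_le] add_mono card_image_le fin)
  also have "card ?I \<le> 2 ^ n" using card_mono[OF _ I] by (simp add: card_Pow)
  also have "card ?J \<le> 4 ^ n"
    using card_mono[OF _ J] by (simp add: card_cartesian_product card_Pow power_mult_distrib[symmetric])
  also have "(2::nat) ^ n \<le> 4 ^ n" by (rule power_mono) auto
  finally show "card uniform_sets \<le> 2 * 4 ^ n" by simp
qed

lemma uniform_sets_large:
  assumes "F \<in> uniform_sets" "2 \<le> exp (-100) * n"
  shows "F \<subseteq> complete_edges {..<n}" "(exp (-100) * n)\<^sup>2 / 4 \<le> card F"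
proof -
  let ?K = "complete_edges {..<n}" and ?g = "exp (-100) * real n"
  show "F \<subseteq> ?K" using assms by (auto simp: uniform_sets_def edges_in_def edges_between_def)
  consider U where "U \<subseteq> {..<n}" "?g \<le> card U" "F = edges_in ?K U"
    | A B where "A \<subseteq> {..<n}" "B \<subseteq> {..<n}" "A \<inter> B = {}" "?g / 2 \<le> card A" "?g / 2 \<le> card B"
      "F = edges_between ?K A B"
    using assms by (auto simp: uniform_sets_def)
  then show "?g\<^sup>2 / 4 \<le> card F"
  proof cases
    case 1
    \<comment> \<open>Since \<open>?g\<close> is at least 2, \<open>card U - 1\<close> is at least
      \<open>?g / 2\<close>.\<close>
    have "?g * (?g / 2) \<le> card U * (real (card U) - 1)"
      using 1 assms(2) by (intro mult_mono) auto
    then show ?thesis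
      using card_edges_in_complete[of "{..<n}" U] 1 by (simp add: power2_eq_square)
  next
    case 2
    have "?g / 2 * (?g / 2) \<le> real (card A) * card B"
      using 2 assms(2) by (intro mult_mono) auto
    then show ?thesis
      using card_edges_between_complete[of "{..<n}" A B] 2 by (simp add: power2_eq_square)
  qed
qed

lemma prob_not_EG_property:
  assumes large: "n \<ge> 1000" "2 \<le> exp (-100) * real n"
  shows "measure_pmf.prob (random_graph n p) {E. \<not> EG_property {..<n} E}
    \<le> ((1 + 1 / (real n)\<^sup>2) ^ n - 1) + 4 * 4 ^ n * exp (- ((exp (-100))\<^sup>2 / 20000 * (n * ln (real n)))) +
      2 / n + (real n + 1) * ((1 + n powr (- 12 / 5)) ^ n - 1)"
proof -
  let ?P = "measure_pmf.prob (random_graph n p)" and ?K = "complete_edges {..<n}" and ?g = "exp (-100) :: real"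
  define A1 where "A1 = {E. \<exists>C\<in>Pow {..<n} - {{}}. 2 \<le> card C \<and> card C \<le> ?g * n \<and>
      (real (card C) - 1) / 2 * (3 / 100 * n * p) < card (E \<inter> edges_in ?K C)}"
  define A2 where "A2 = {E. \<exists>F\<in>uniform_sets. \<not> (99 / 100 * (p * card F) \<le> card (E \<inter> F)
      \<and> card (E \<inter> F) \<le> 101 / 100 * (p * card F))}"
  define A3 where "A3 = {E. \<exists>v\<in>{..<n}. card (E \<inter> edges_between ?K {v} ({..<n} - {v})) < n * p / 4}"
  define A4 where "A4 = {E. \<exists>S\<in>Pow {..<n} - {{}}. \<exists>w\<in>{..n}.
      w \<le> card ({..<n} - S) \<and> w \<le> 22 / 100 * real n \<and>
      card S * (n * p * (if w < ?g / 2 * n then 22 / 100 else 75 / 100))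
        \<le> card (edges_between E S (light_set E {..<n} S w))}"
  have P1: "?P A1 \<le> (1 + 1 / (real n)\<^sup>2) ^ n - 1"
    unfolding A1_def by (rule prob_small_sparse_fails)
  have P2: "?P A2 \<le> 4 * 4 ^ n * exp (- (?g\<^sup>2 / 20000 * (n * ln (real n))))"
  proof -
    have "?P A2 \<le> card uniform_sets * (2 * exp (- (p * ((?g * n)\<^sup>2 / 4) / 40000)))"
      unfolding A2_def
      by (rule prob_concentration_fails) (use finite_uniform_sets uniform_sets_large large in auto)
    also have "\<dots> \<le> (2 * 4 ^ n) * (2 * exp (- (?g\<^sup>2 / 20000 * (n * ln (real n)))))"
    proof (rule mult_mono)
      have "real (card uniform_sets) \<le> real (2 * 4 ^ n)" using card_uniform_sets by (rule of_nat_mono)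
      then show "real (card uniform_sets) \<le> 2 * 4 ^ n" by simp
      have "?g\<^sup>2 / 160000 * n * (8 * ln (real n)) \<le> ?g\<^sup>2 / 160000 * n * (n * p)"
        using p(3) by (intro mult_left_mono) auto
      then have "?g\<^sup>2 / 20000 * (n * ln (real n)) \<le> p * ((?g * n)\<^sup>2 / 4) / 40000"
        by (simp add: power2_eq_square algebra_simps)
      then show "2 * exp (- (p * ((?g * n)\<^sup>2 / 4) / 40000)) \<le> 2 * exp (- (?g\<^sup>2 / 20000 * (n * ln (real n))))"
        by simp
    qed auto
    finally show ?thesis by simp
  qed
  have P3: "?P A3 \<le> 2 / n" unfolding A3_def by (rule prob_min_degree_fails)
  have P4: "?P A4 \<le> (real n + 1) * ((1 + n powr (- 12 / 5)) ^ n - 1)"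
    unfolding A4_def by (rule prob_light_set_sparse_fails)
  \<comment> \<open>The deterministic part: a graph avoiding all four failure events is pseudorandom
    with \<open>\<gamma> = exp (-100)\<close>.\<close>
  have good: "EG_property {..<n} E" if E: "E \<subseteq> ?K" "E \<notin> A1" "E \<notin> A2" "E \<notin> A3" "E \<notin> A4" for E
  proof -
    note in_eq = edges_in_eq[OF E(1)] and between_eq = edges_between_eq[OF E(1)]
    have conc: "99 / 100 * (p * card F) \<le> card (E \<inter> F)" "card (E \<inter> F) \<le> 101 / 100 * (p * card F)"
      if "F \<in> uniform_sets" for F
      using E(3) that by (auto simp: A2_def)
    interpret pseudorandom "{..<n}" E p ?g
    proof unfold_locales
      have "0 < 8 * ln (real n)" using n by simp
      then have "0 < n * p" using p(3) by linarith
      then show "p > 0" by (simp add: zero_less_mult_iff)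
      show "?g \<le> 1 / 100"
        using exp_ge_add_one_self[of "100 :: real"] by (simp add: exp_minus field_simps)
    next
      fix C assume C: "C \<subseteq> {..<n}" "2 \<le> card C" "card C \<le> ?g * card {..<n}"
      then have "C \<in> Pow {..<n} - {{}}" by auto
      then have "\<not> (real (card C) - 1) / 2 * (3 / 100 * n * p) < card (E \<inter> edges_in ?K C)"
        using E(2) C by (auto simp: A1_def)
      then show "card (edges_in E C) \<le> (real (card C) - 1) / 2 * (3 / 100 * card {..<n} * p)"
        unfolding in_eq by simp
    next
      fix U assume U: "U \<subseteq> {..<n}" "?g * card {..<n} \<le> card U"
      then have "edges_in ?K U \<in> uniform_sets" by (auto simp: uniform_sets_def)
      then show "99 / 100 * (p * (card U * (real (card U) - 1) / 2)) \<le> card (edges_in E U)"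
        "card (edges_in E U) \<le> 101 / 100 * (p * (card U * (real (card U) - 1) / 2))"
        using conc[of "edges_in ?K U"] card_edges_in_complete[of "{..<n}" U] U(1)
        unfolding in_eq by simp_all
    next
      fix A B assume AB: "A \<subseteq> {..<n}" "B \<subseteq> {..<n}" "A \<inter> B = {}"
        "?g / 2 * card {..<n} \<le> card A" "?g / 2 * card {..<n} \<le> card B"
      then have "edges_between ?K A B \<in> uniform_sets" by (auto simp: uniform_sets_def)
      then show "99 / 100 * (p * (card A * card B)) \<le> card (edges_between E A B)"
        using conc(1)[of "edges_between ?K A B"] card_edges_between_complete[of "{..<n}" A B] AB(1-3)
        unfolding between_eq by simp
    next
      fix v assume v: "v \<in> {..<n}"
      have "{e \<in> E. v \<in> e} = E \<inter> edges_between ?K {v} ({..<n} - {v})"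
        using E(1) v by (auto simp: edges_between_def complete_edges_def card_2_iff)
      then have "vertex_degree E v = card (E \<inter> edges_between ?K {v} ({..<n} - {v}))"
        by (simp add: vertex_degree_def)
      then show "card {..<n} * p / 4 \<le> vertex_degree E v"
        using E(4) v by (auto simp: A3_def not_less)
    next
      fix S w assume S: "S \<subseteq> {..<n}" "S \<noteq> {}" and w: "w \<le> card ({..<n} - S)" "w \<le> 22 / 100 * card {..<n}"
      have "w \<le> n" using w(1) card_mono[of "{..<n}" "{..<n} - S"] by auto
      then show "card (edges_between E S (light_set E {..<n} S w))
        < card S * (card {..<n} * p * (if w < ?g / 2 * card {..<n} then 22 / 100 else 75 / 100))"
        using E(5) S w unfolding A4_def by (fastforce simp: not_le)
    qed (use E(1) large in auto)
    show ?thesis by (rule has_EG_property)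
  qed
  have "?P {E. \<not> EG_property {..<n} E} = ?P ({E. \<not> EG_property {..<n} E} \<inter> set_pmf (random_graph n p))"
    by (simp add: measure_Int_set_pmf)
  also have "\<dots> \<le> ?P (A1 \<union> A2 \<union> A3 \<union> A4)"
    using good set_random_subset[of ?K p] unfolding random_graph_eq
    by (intro measure_pmf.finite_measure_mono) auto
  also have "\<dots> \<le> ?P A1 + ?P A2 + ?P A3 + ?P A4"
    by (intro order_trans[OF measure_Un_le] add_mono) auto
  finally show ?thesis using P1 P2 P3 P4 by linarith
qed

end

section \<open>Passage to the limit\<close>

theorem theorem1p2:
  fixes p :: "nat \<Rightarrow> real"
  assumes "\<And>n. 0 \<le> p n" and "\<And>n. p n \<le> 1"
    and "\<forall>\<^sub>F n in sequentially. p n \<ge> 8 * ln (real n) / real n"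
  shows "(\<lambda>n. measure_pmf.prob (random_graph n (p n)) {E. EG_property {..<n} E})
           \<longlonglongrightarrow> 1"
proof -
  define b where "b n = ((1 + 1 / (real n)\<^sup>2) ^ n - 1)
      + 4 * 4 ^ n * exp (- ((exp (-100))\<^sup>2 / 20000 * (n * ln (real n))))
      + 2 / n + (real n + 1) * ((1 + n powr (- 12 / 5)) ^ n - 1)" for n :: nat
  have "b \<longlonglongrightarrow> 0"
  proof -
    \<comment> \<open>Only positivity of this tiny constant matters for the limit, so it is kept
      symbolic.\<close>
    define c :: real where "c = (exp (-100))\<^sup>2 / 20000"
    have c: "c > 0" by (simp add: c_def)
    have "(\<lambda>n::nat. (1 + 1 / (real n)\<^sup>2) ^ n - 1) \<longlonglongrightarrow> 0" by real_asymp
    moreover have "(\<lambda>n::nat. 4 * 4 ^ n * exp (- (c * (n * ln (real n))))) \<longlonglongrightarrow> 0"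
      using c by real_asymp
    moreover have "(\<lambda>n::nat. 2 / real n) \<longlonglongrightarrow> 0" by real_asymp
    moreover have "(\<lambda>n::nat. (real n + 1) * ((1 + n powr (- 12 / 5)) ^ n - 1)) \<longlonglongrightarrow> 0"
      by real_asymp
    ultimately have "b \<longlonglongrightarrow> 0 + 0 + 0 + 0"
      unfolding b_def c_def[symmetric] by (intro tendsto_add)
    then show ?thesis by simp
  qed
  then have lim: "(\<lambda>n. 1 - b n) \<longlonglongrightarrow> 1" using tendsto_diff[OF tendsto_const[of 1]] by fastforce
  have "\<forall>\<^sub>F n :: nat in sequentially. n \<ge> 1000 \<and> 2 \<le> exp (-100) * real n"
    by (intro eventually_conj eventually_ge_at_top) real_asymp
  then have "\<forall>\<^sub>F n in sequentially. 1 - b n \<le> measure_pmf.prob (random_graph n (p n)) {E. EG_property {..<n} E}"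
    using assms(3)
  proof eventually_elim
    case (elim n)
    then have "8 * ln (real n) \<le> n * p n" by (simp add: field_simps)
    then have "measure_pmf.prob (random_graph n (p n)) {E. \<not> EG_property {..<n} E} \<le> b n"
      unfolding b_def using elim by (intro prob_not_EG_property assms) auto
    moreover have "{E. \<not> EG_property {..<n} E} = UNIV - {E. EG_property {..<n} E}" by auto
    ultimately show ?case
      using measure_pmf.prob_compl[of "{E. EG_property {..<n} E}" "random_graph n (p n)"] by simp
  qed
  then show ?thesis
    by (rule tendsto_sandwich[OF _ _ lim tendsto_const]) auto
qed

end
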